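(* Let $h=(1,h_1,\dots,h_{e-1},h_e=t)$ be a level $h$-vector, and suppose that, for each $i=1,2,\dots,e-1$, the following inequality is satisfied: $$h_{e-i}+t^2-t\,h_i-1>0.$$ Then $(1,h_1,\dots,h_{e-1},t-1)$ is also a level $h$-vector.
   Context: Let $k$ be a field of characteristic zero. All algebras are standard graded artinian algebras $A=R/I$, where $R=k[x_1,\dots,x_r]$, all $x_i$ have degree $1$, and $I$ is a homogeneous ideal of $R$ containing no nonzero forms of degree $1$. The $h$-vector of $A$ is $h(A)=(h_0,h_1,\dots,h_e)$, where $h_i=\dim_k A_i$ and $e$ is the last index with $\dim_k A_e>0$; thus $h_0=1$ and $h_1=r$. The integer $e$ is the socle degree. The socle of $A$ is the annihilator in $A$ of its homogeneous maximal ideal. $A$ is level of type $t$ if its socle is concentrated in degree $e$ and has dimension $t=h_e$. An $h$-vector is level if it is the $h$-vector of some level standard graded artinian algebra $A=k[x_1,\dots,x_r]/I$, where all $x_i$ have degree $1$ and $I$ is a homogeneous ideal containing no nonzero forms of degree $1$. *)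

theory Defs
  imports "HOL-Library.Poly_Mapping" "HOL-Algebra.Embedded_Algebras" "HOL-Algebra.QuotRing"
begin

text \<open>
  Exponent vectors are finitely supported functions on the natural numbers and polynomials are
  finitely supported functions on exponent vectors. The ring in the variables
  \<open>x\<^sub>0, \<dots>, x\<^bsub>r-1\<^esub>\<close> (indices shifted by one) is cut out as a carrier, so that the number of
  variables can be quantified over.
\<close>

type_synonym 'k mpoly = "(nat \<Rightarrow>\<^sub>0 nat) \<Rightarrow>\<^sub>0 'k"

definition mon_deg :: "(nat \<Rightarrow>\<^sub>0 nat) \<Rightarrow> nat"
  where "mon_deg m = (\<Sum>j\<in>Poly_Mapping.keys m. Poly_Mapping.lookup m j)"

definition poly_ring :: "nat \<Rightarrow> 'k::field mpoly ring"
  where "poly_ring r =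
    \<lparr>carrier = {p. \<forall>m\<in>Poly_Mapping.keys p. Poly_Mapping.keys m \<subseteq> {..<r}},
     mult = (*), one = 1, zero = 0, add = (+)\<rparr>"

text \<open>The forms of degree \<open>d\<close>; the zero polynomial is included for every \<open>d\<close>.\<close>

definition forms :: "nat \<Rightarrow> nat \<Rightarrow> 'k::field mpoly set"
  where "forms r d = {p \<in> carrier (poly_ring r). \<forall>m\<in>Poly_Mapping.keys p. mon_deg m = d}"

definition hom_component :: "nat \<Rightarrow> 'k::field mpoly \<Rightarrow> 'k mpoly"
  where "hom_component d p = Poly_Mapping.mapp (\<lambda>m c. if mon_deg m = d then c else 0) p"

definition homogeneous_ideal :: "nat \<Rightarrow> 'k::field mpoly set \<Rightarrow> bool"
  where "homogeneous_ideal r I \<longleftrightarrow>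
    ideal I (poly_ring r) \<and> (\<forall>p\<in>I. \<forall>d. hom_component d p \<in> I)"

definition artinian_ring :: "('a, 'b) ring_scheme \<Rightarrow> bool"
  where "artinian_ring A \<longleftrightarrow> ring A \<and> 
    (\<forall>J :: nat \<Rightarrow> 'a set. (\<forall>n. ideal (J n) A) \<and> (\<forall>n. J (Suc n) \<subseteq> J n) \<longrightarrow>
       (\<exists>N. \<forall>n\<ge>N. J n = J N))"

text \<open>Properness of \<open>I\<close> is implicit in the convention \<open>h\<^sub>0 = 1\<close>; it only matters for \<open>r = 0\<close>.\<close>

definition standard_graded_artinian :: "nat \<Rightarrow> 'k::field mpoly set \<Rightarrow> bool"
  where "standard_graded_artinian r I \<longleftrightarrow>
    homogeneous_ideal r I \<and> I \<noteq> carrier (poly_ring r) \<and> I \<inter> forms r 1 = {0} \<and>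
    artinian_ring (poly_ring r Quot I)"

definition proj :: "nat \<Rightarrow> 'k::field mpoly set \<Rightarrow> 'k mpoly \<Rightarrow> 'k mpoly set"
  where "proj r I p = I +>\<^bsub>poly_ring r\<^esub> p"

text \<open>The copy of the ground field inside \<open>A = R/I\<close>.\<close>

definition scalars :: "nat \<Rightarrow> 'k::field mpoly set \<Rightarrow> 'k mpoly set set"
  where "scalars r I = proj r I ` range (Poly_Mapping.single 0)"

definition graded_component :: "nat \<Rightarrow> 'k::field mpoly set \<Rightarrow> nat \<Rightarrow> 'k mpoly set set"
  where "graded_component r I i = proj r I ` forms r i"

text \<open>\<open>has_dim r I V n\<close>: the \<open>k\<close>-subspace \<open>V\<close> of \<open>A = R/I\<close> has dimension \<open>n\<close>.\<close>

definition has_dim :: "nat \<Rightarrow> 'k::field mpoly set \<Rightarrow> 'k mpoly set set \<Rightarrow> nat \<Rightarrow> bool"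
  where "has_dim r I V n \<longleftrightarrow> ring.dimension (poly_ring r Quot I) n (scalars r I) V"

definition hom_maximal_ideal :: "nat \<Rightarrow> 'k::field mpoly set \<Rightarrow> 'k mpoly set set"
  where "hom_maximal_ideal r I =
    proj r I ` {p \<in> carrier (poly_ring r). Poly_Mapping.lookup p 0 = 0}"

definition socle :: "nat \<Rightarrow> 'k::field mpoly set \<Rightarrow> 'k mpoly set set"
  where "socle r I = {a \<in> carrier (poly_ring r Quot I).
    \<forall>b\<in>hom_maximal_ideal r I. a \<otimes>\<^bsub>poly_ring r Quot I\<^esub> b = \<zero>\<^bsub>poly_ring r Quot I\<^esub>}"

text \<open>
  An \<open>h\<close>-vector \<open>(h\<^sub>0, \<dots>, h\<^sub>e)\<close> is encoded as the function \<open>i \<mapsto> dim A\<^sub>i\<close> on all natural numbers,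
  that is, extended by zero beyond the last index \<open>e\<close> with \<open>h\<^sub>e > 0\<close>.
\<close>

definition is_h_vector_of :: "nat \<Rightarrow> 'k::field mpoly set \<Rightarrow> (nat \<Rightarrow> nat) \<Rightarrow> bool"
  where "is_h_vector_of r I h \<longleftrightarrow> (\<forall>i. has_dim r I (graded_component r I i) (h i))"

definition socle_degree :: "(nat \<Rightarrow> nat) \<Rightarrow> nat \<Rightarrow> bool"
  where "socle_degree h e \<longleftrightarrow> h e > 0 \<and> (\<forall>i>e. h i = 0)"

definition level_of_type :: "nat \<Rightarrow> 'k::field mpoly set \<Rightarrow> nat \<Rightarrow> bool"
  where "level_of_type r I t \<longleftrightarrow>
    (\<exists>h e. is_h_vector_of r I h \<and> socle_degree h e \<and>
       socle r I \<subseteq> graded_component r I e \<and> has_dim r I (socle r I) t \<and> t = h e)"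

definition level_h_vector :: "'k::field itself \<Rightarrow> (nat \<Rightarrow> nat) \<Rightarrow> bool"
  where "level_h_vector _ h \<longleftrightarrow>
    (\<exists>r (I :: 'k mpoly set) t. standard_graded_artinian r I \<and> is_h_vector_of r I h \<and>
       level_of_type r I t)"

end

theory Submission
  imports Defs
begin

text \<open>
  For \<open>e \<ge> 2\<close> the inequalities for \<open>i = 1\<close> and \<open>i = e - 1\<close> force \<open>t \<ge> 2\<close>; take
  \<open>A' = A/(v)\<close> with a suitable nonzero \<open>v \<in> A\<^sub>e\<close>. Only the last entry of the
  \<open>h\<close>-vector changes, and since \<open>A\<close> is level, \<open>A'\<close> fails to be level only if some nonzero
  \<open>a \<in> A\<^bsub>e-1\<^esub>\<close> has \<open>a A\<^sub>1 \<subseteq> k v\<close>. If every \<open>v\<close> were bad, choose bad elements \<open>a\<^sub>1, \<dots>, a\<^sub>t\<close> for a basis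
  \<open>v\<^sub>1, \<dots>, v\<^sub>t\<close> of \<open>A\<^sub>e\<close> and \<open>a\<^sub>0\<close> for \<open>v\<^sub>1 + \<dots> + v\<^sub>t\<close>. The multiplication maps of linear forms
  \<open>A\<^bsub>e-1\<^esub> \<rightarrow> A\<^sub>e\<close> respect these lines, which puts them in a space of dimension at most
  \<open>t h\<^bsub>e-1\<^esub> - t\<^sup>2 + 1\<close>; as \<open>A\<^sub>1\<close> acts faithfully, this contradicts the inequality for \<open>i = e - 1\<close>.
  For \<open>e = 1\<close> the algebra \<open>k[x\<^sub>1, \<dots>, x\<^bsub>t-1\<^esub>]/m\<^sup>2\<close>, with \<open>m\<close> the maximal ideal, does the job.
\<close>

section \<open>Linear algebra\<close>

text \<open>
  Constants defined directly in \<^locale>\<open>vector_space\<close> would be captured by its global interpretation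
  for real vector spaces.
\<close>

locale lin_space = vector_space scale
  for scale :: "'a::field \<Rightarrow> 'b::ab_group_add \<Rightarrow> 'b" (infixr \<open>*s\<close> 75)
begin

text \<open>A relation rather than a function, so that it asserts finite dimension and, through the
  equation with the span, that \<open>V\<close> is a subspace.\<close>

definition has_vdim :: "'b set \<Rightarrow> nat \<Rightarrow> bool"
  where "has_vdim V n \<longleftrightarrow> (\<exists>B. finite B \<and> independent B \<and> card B = n \<and> span B = V)"

lemma has_vdim_subspace: "has_vdim V n \<Longrightarrow> subspace V"
  unfolding has_vdim_def by auto

lemma has_vdim_independent_le:
  assumes "has_vdim V n" "independent S" "S \<subseteq> V"
  shows "finite S" "card S \<le> n"
  using assms independent_span_bound[of _ S] unfolding has_vdim_def by blast+

lemma has_vdim_basis: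
  assumes "has_vdim V n" "independent B" "span B = V"
  shows "finite B" "card B = n"
proof -
  obtain C where C: "finite C" "independent C" "card C = n" "span C = V"
    using assms(1) by (auto simp: has_vdim_def)
  have *: "finite B" "card B \<le> n"
    using has_vdim_independent_le[OF assms(1,2)] assms(3) span_superset by auto
  show "finite B" by fact
  have "card C \<le> card B"
    using independent_span_bound[OF *(1) C(2)] C(4) assms(3) span_superset by auto
  then show "card B = n" using * C by simp
qed

lemma has_vdim_unique: "has_vdim V n \<Longrightarrow> has_vdim V m \<Longrightarrow> n = m"
  using has_vdim_basis by (metis has_vdim_def)

lemma has_vdim_extend:
  assumes "has_vdim V n" "independent S" "S \<subseteq> V"
  obtains B where "S \<subseteq> B" "finite B" "independent B" "card B = n" "span B = V"
proof -
  obtain B where B: "S \<subseteq> B" "B \<subseteq> V" "independent B" "V \<subseteq> span B"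
    using maximal_independent_subset_extend[OF assms(3,2)] by metis
  have "span B = V"
    using B has_vdim_subspace[OF assms(1)] by (intro span_subspace) auto
  then show ?thesis using that B has_vdim_basis[OF assms(1) B(3)] by blast
qed

text \<open>A basis of \<open>U\<close> extends to one of \<open>V\<close>, and if both have the
  same size nothing was added. The equality clause is what later stops descending chains of
  ideals.\<close>

lemma has_vdim_subspace_le:
  assumes "subspace U" "U \<subseteq> V" "has_vdim V n"
  shows "\<exists>m\<le>n. has_vdim U m \<and> (m = n \<longrightarrow> U = V)"
proof -
  obtain B where B: "B \<subseteq> U" "independent B" "U \<subseteq> span B"
    using maximal_independent_subset[of U] by metis
  have sp: "span B = U" using B assms(1) by (intro span_subspace) auto
  have BV: "B \<subseteq> V" using B assms by auto
  have fin: "finite B" and le: "card B \<le> n"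
    using has_vdim_independent_le[OF assms(3) B(2) BV] by auto
  obtain C where C: "B \<subseteq> C" "finite C" "independent C" "card C = n" "span C = V"
    using has_vdim_extend[OF assms(3) B(2) BV] by metis
  have "U = V" if "card B = n"
    using C that card_subset_eq[of C B] sp by auto
  then show ?thesis
    using fin le sp B(2) unfolding has_vdim_def by (intro exI[of _ "card B"]) auto
qed

lemma has_vdim_if_spanned:
  assumes "subspace V" "V \<subseteq> span F" "finite F"
  shows "\<exists>n. has_vdim V n"
proof -
  obtain B where B: "B \<subseteq> F" "independent B" "F \<subseteq> span B"
    using maximal_independent_subset[of F] by metis
  have "has_vdim (span B) (card B)"
    using B assms(3) finite_subset unfolding has_vdim_def by blast
  moreover have "V \<subseteq> span B"
    using assms(2) span_mono[OF B(3)] by (simp add: span_span) 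
  ultimately show ?thesis using has_vdim_subspace_le[OF assms(1)] by blast
qed

text \<open>The coordinates of \<open>x\<close> with respect to \<open>B\<close> are supported both
  in \<open>S\<close> and in \<open>T\<close>, hence nowhere.\<close>

lemma independent_span_Int:
  assumes "independent B" "S \<subseteq> B" "T \<subseteq> B" "S \<inter> T = {}" "x \<in> span S" "x \<in> span T"
  shows "x = 0"
proof -
  have "representation B x = representation S x" "representation B x = representation T x"
    using assms by (auto intro!: representation_extend)
  then have "representation B x b = 0" for b
    using representation_ne_zero[of S x b] representation_ne_zero[of T x b] assms(4) by auto
  moreover have "x \<in> span B" using assms span_mono by blast
  ultimately show ?thesis
    using sum_nonzero_representation_eq[OF assms(1), of x] by simp
qed

text \<open>Rank-nullity as an inequality: a basis \<open>K\<close> of the kernel extends to a basis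
  \<open>B\<close> of the span of \<open>A\<close>, and \<open>f\<close> maps \<open>B - K\<close>
  injectively to an independent set in the span of \<open>G\<close>. The form without subtraction
  suits iteration.\<close>

lemma kernel_card_bound:
  assumes lin: "Vector_Spaces.linear scale scale f"
    and A: "independent A" "finite A" and G: "finite G" "f ` A \<subseteq> span G"
  shows "\<exists>K. independent K \<and> finite K \<and> K \<subseteq> span A \<and> (\<forall>k\<in>K. f k = 0) \<and> card A \<le> card K + card G"
proof -
  interpret f: module_hom scale scale f
    using lin by (simp add: module_hom_iff_linear)
  define N where "N = {x \<in> span A. f x = 0}"
  have sN: "subspace N"
    unfolding N_def by (auto simp: subspace_def f.add f.scale span_add span_scale span_zero)
  have V: "has_vdim (span A) (card A)" using A by (auto simp: has_vdim_def)
  obtain K where K: "K \<subseteq> N" "independent K" "N \<subseteq> span K"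
    using maximal_independent_subset[of N] by metis
  obtain B where B: "K \<subseteq> B" "finite B" "independent B" "card B = card A" "span B = span A"
    using has_vdim_extend[OF V K(2)] K(1) unfolding N_def by blast
  have inj: "inj_on f (span (B - K))"
  proof (subst f.inj_on_iff_eq_0; safe)
    show "x = 0" if x: "x \<in> span (B - K)" "f x = 0" for x
    proof -
      have "x \<in> span A" using x(1) span_mono[of "B - K" B] B(5) by auto
      then have "x \<in> span K" using x(2) K(3) unfolding N_def by auto
      then show ?thesis using independent_span_Int[OF B(3) B(1), of "B - K"] x(1) by auto
    qed
  qed
  have ind: "independent (f ` (B - K))"
    by (rule f.independent_injective_image[OF independent_mono[OF B(3) Diff_subset] inj])
  have "f ` (B - K) \<subseteq> f ` span A" using B(5) span_superset by blast
  also have "\<dots> = span (f ` A)" by (simp add: f.span_image)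
  also have "\<dots> \<subseteq> span G" using G(2) by (simp add: span_minimal)
  finally have "card (f ` (B - K)) \<le> card G"
    using independent_span_bound[OF G(1) ind] by simp
  moreover have "card (f ` (B - K)) = card (B - K)"
    using inj inj_on_subset span_superset by (intro card_image) blast
  moreover have fK: "finite K" using finite_subset[OF B(1,2)] .
  moreover have "card (B - K) = card B - card K"
    using card_Diff_subset[OF fK B(1)] .
  ultimately show ?thesis
    using K(1,2) B(4) unfolding N_def by (intro exI[of _ K]) auto
qed

text \<open>Passing to the kernel of \<open>f c\<close> costs at most \<open>card (G c)\<close>
  dimensions, so at least one dimension survives all maps. The set \<open>A\<close> varies in the
  induction because each step replaces it by an independent set in the kernel.\<close>

lemma common_kernel_nonzero:
  assumes "finite C"
    and "\<And>c. c \<in> C \<Longrightarrow> Vector_Spaces.linear scale scale (f c)"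
    and "\<And>c. c \<in> C \<Longrightarrow> finite (G c) \<and> f c ` span A \<subseteq> span (G c)"
    and "independent A" "finite A" "(\<Sum>c\<in>C. card (G c)) < card A"
  shows "\<exists>x\<in>span A. x \<noteq> 0 \<and> (\<forall>c\<in>C. f c x = 0)"
  using assms
proof (induction C arbitrary: A rule: finite_induct)
  case empty
  then obtain a where a: "a \<in> A" by (auto simp: card_gt_0_iff)
  have "a \<noteq> 0" using a empty(3) dependent_zero[of A] by auto
  then show ?case using span_base[OF a] by auto
next
  case (insert c C)
  obtain K where K: "independent K" "finite K" "K \<subseteq> span A" "\<forall>k\<in>K. f c k = 0"
      "card A \<le> card K + card (G c)"
  proof -
    have G: "finite (G c)" "f c ` A \<subseteq> span (G c)"
      using insert.prems(2)[of c] image_mono[OF span_superset[of A], of "f c"] by auto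
    show ?thesis
      using kernel_card_bound[OF insert.prems(1)[OF insertI1] insert.prems(3,4) G] that by metis
  qed
  have KA: "span K \<subseteq> span A" using K(3) by (simp add: span_minimal)
  have *: "(\<Sum>c\<in>C. card (G c)) < card K" using K(5) insert by auto
  have "\<exists>x\<in>span K. x \<noteq> 0 \<and> (\<forall>d\<in>C. f d x = 0)"
  proof (rule insert.IH[OF _ _ K(1,2) *])
    show "Vector_Spaces.linear scale scale (f d)" if "d \<in> C" for d
      using that insert.prems(1) by simp
    show "finite (G d) \<and> f d ` span K \<subseteq> span (G d)" if "d \<in> C" for d
      using that insert.prems(2)[of d] image_mono[OF KA, of "f d"] by auto
  qed
  then obtain x where x: "x \<in> span K" "x \<noteq> 0" "\<forall>d\<in>C. f d x = 0" by blast
  interpret f: module_hom scale scale "f c"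
    using insert.prems(1)[of c] by (simp add: module_hom_iff_linear)
  have "f c x = 0" using f.eq_0_on_span[OF _ x(1)] K(4) by blast
  then show ?case using x KA by blast
qed

text \<open>Coefficients are indexed by \<open>I\<close>, not by vectors, so the hypothesis also
  excludes repetitions: \<open>u i = u j\<close> would give a relation with coefficients 1 and
  -1.\<close>

lemma independent_family:
  assumes "finite I" "\<And>c. (\<Sum>i\<in>I. c i *s u i) = 0 \<Longrightarrow> \<forall>i\<in>I. c i = 0"
  shows "inj_on u I" "independent (u ` I)"
proof -
  show inj: "inj_on u I"
  proof (rule inj_onI, rule ccontr)
    fix i j assume ij: "i \<in> I" "j \<in> I" "u i = u j" "i \<noteq> j"
    define c where "c k = (if k = i then 1 else if k = j then - 1 else 0 :: 'a)" for k
    have "(\<Sum>k\<in>I. c k *s u k) = (\<Sum>k\<in>{i, j}. c k *s u k)"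
      using assms(1) ij by (intro sum.mono_neutral_right) (auto simp: c_def)
    also have "\<dots> = 0" using ij by (simp add: c_def)
    finally show False using assms(2)[of c] ij(1) by (auto simp: c_def)
  qed
  show "independent (u ` I)"
  proof (rule independent_if_scalars_zero)
    fix f x assume s: "(\<Sum>x\<in>u ` I. f x *s x) = 0" and x: "x \<in> u ` I"
    have "(\<Sum>i\<in>I. f (u i) *s u i) = 0" using s by (simp add: sum.reindex[OF inj])
    then show "f x = 0" using assms(2)[of "f \<circ> u"] x by auto
  qed (use assms(1) in simp)
qed

lemma span_image_finite:
  assumes "finite I" "x \<in> span (u ` I)" "inj_on u I"
  shows "\<exists>c. x = (\<Sum>i\<in>I. c i *s u i)"
proof -
  obtain d where "x = (\<Sum>y\<in>u ` I. d y *s y)"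
    using assms(1,2) by (auto simp: span_finite)
  then have "x = (\<Sum>i\<in>I. d (u i) *s u i)" by (simp add: sum.reindex[OF assms(3)])
  then show ?thesis by (intro exI[of _ "d \<circ> u"]) simp
qed

section \<open>Images under linear maps, and linear projections\<close>

lemma has_vdim_0_iff: "has_vdim V 0 \<longleftrightarrow> V = {0}"
  unfolding has_vdim_def using independent_empty by (auto simp: card_eq_0_iff)

lemma has_vdim_image_inj:
  assumes f: "Vector_Spaces.linear scale scale f" and V: "has_vdim V n"
    and inj: "\<And>x. x \<in> V \<Longrightarrow> f x = 0 \<Longrightarrow> x = 0"
  shows "has_vdim (f ` V) n"
proof -
  interpret f: module_hom scale scale f
    using f by (simp add: module_hom_iff_linear)
  obtain B where B: "finite B" "independent B" "card B = n" "span B = V"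
    using V by (auto simp: has_vdim_def)
  have inj': "inj_on f (span B)"
    unfolding f.inj_on_iff_eq_0[OF subspace_span] using inj B(4) by blast
  have "card (f ` B) = card B"
    using inj_on_subset[OF inj' span_superset] by (rule card_image)
  moreover have "independent (f ` B)"
    using f.independent_injective_image[OF B(2) inj'] .
  moreover have "span (f ` B) = f ` V" using B(4) by (simp add: f.span_image)
  ultimately show ?thesis using B(1,3) unfolding has_vdim_def by blast
qed

text \<open>Extend \<open>z\<close> to a basis of \<open>V\<close>: \<open>f\<close> kills
  \<open>z\<close> and is injective on the span of the other basis vectors. This gives the drop by
  one in the last entry of the h-vector.\<close>

lemma has_vdim_image_kernel_line:
  assumes f: "Vector_Spaces.linear scale scale f" and V: "has_vdim V (Suc n)"
    and z: "z \<in> V" "z \<noteq> 0" and ker: "\<And>x. f x = 0 \<longleftrightarrow> x \<in> span {z}"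
  shows "has_vdim (f ` V) n"
proof -
  interpret f: module_hom scale scale f
    using f by (simp add: module_hom_iff_linear)
  have "independent {z}" using z(2) by simp
  then obtain B where B: "z \<in> B" "finite B" "independent B" "card B = Suc n" "span B = V"
    using has_vdim_extend[OF V, of "{z}"] z(1) by auto
  have vd: "has_vdim (span (B - {z})) n"
    using B independent_mono[OF B(3) Diff_subset[of B "{z}"]] unfolding has_vdim_def
    by (intro exI[of _ "B - {z}"]) auto
  have "x = 0" if "x \<in> span (B - {z})" "f x = 0" for x
    using independent_span_Int[OF B(3), of "B - {z}" "{z}" x] that ker B(1) by auto
  with has_vdim_image_inj[OF f vd] have "has_vdim (f ` span (B - {z})) n" by blast
  moreover have "f ` V = f ` span (B - {z})"
  proof -
    have "f z = 0" using ker span_base by blast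
    have "f ` V = span (f ` B)" using B(5) by (simp add: f.span_image)
    also have "f ` B = insert 0 (f ` (B - {z}))" using B(1) \<open>f z = 0\<close> by auto
    also have "span (insert 0 (f ` (B - {z}))) = f ` span (B - {z})" by (simp add: f.span_image)
    finally show ?thesis .
  qed
  ultimately show ?thesis by simp
qed

text \<open>A basis of \<open>S\<close> is sent to 0 and the remaining vectors of a basis of the
  whole space are fixed. The image then serves as a model of the quotient by \<open>S\<close> inside
  the space itself.\<close>

lemma exists_linear_projection:
  assumes "subspace S"
  shows "\<exists>f. Vector_Spaces.linear scale scale f \<and> (\<forall>x. f x = 0 \<longleftrightarrow> x \<in> S) \<and> (\<forall>x. x - f x \<in> S)"
proof -
  interpret vector_space_pair scale scale by unfold_locales
  obtain B0 where B0: "B0 \<subseteq> S" "independent B0" "S \<subseteq> span B0"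
    using maximal_independent_subset[of S] by metis
  obtain B where B: "B0 \<subseteq> B" "independent B" "span B = UNIV"
    using extend_basis_superset[OF B0(2)] independent_extend_basis[OF B0(2)] span_extend_basis[OF B0(2)]
    by metis
  obtain f where f: "Vector_Spaces.linear scale scale f" "\<forall>b\<in>B. f b = (if b \<in> B0 then 0 else b)"
    using linear_independent_extend[OF B(2), of "\<lambda>b. if b \<in> B0 then 0 else b"] by blast
  interpret f: module_hom scale scale f
    using f(1) by (simp add: module_hom_iff_linear)
  have diff: "x - f x \<in> S" for x
  proof -
    have "x \<in> span B" using B(3) by simp
    then show ?thesis
    proof (induction rule: span_induct_alt)
      case base
      then show ?case using assms by (simp add: f.zero subspace_0)
    next
      case (step c b y)
      have "b - f b \<in> S" using f(2) step(1) B0(1) assms by (auto simp: subspace_0)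
      moreover have "c *s b + y - f (c *s b + y) = c *s (b - f b) + (y - f y)"
        by (simp add: f.add f.scale scale_right_diff_distrib)
      ultimately show ?case using assms step(2) by (metis subspace_add subspace_scale)
    qed
  qed
  have "f x = 0 \<longleftrightarrow> x \<in> S" for x
  proof
    show "x \<in> S" if "f x = 0" using diff[of x] that by simp
    show "f x = 0" if "x \<in> S"
    proof (rule f.eq_0_on_span)
      show "f b = 0" if "b \<in> B0" for b using that f(2) B(1) by auto
      show "x \<in> span B0" using that B0(3) by blast
    qed
  qed
  then show ?thesis using f(1) diff by blast
qed

text \<open>\<open>X\<close>, \<open>Y\<close>, \<open>Z\<close> stand for \<open>A_1\<close>,
  \<open>A_(e-1)\<close>, \<open>A_e\<close>, and \<open>ineq\<close> is the inequality for
  \<open>i = e - 1\<close> rearranged to avoid subtraction. If every \<open>z\<close> were bad,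
  choose bad elements \<open>u z\<close>; counting the conditions for \<open>x\<close> to annihilate
  a basis of \<open>Y\<close> that contains many of them yields a nonzero \<open>x\<close>
  annihilating \<open>Y\<close>.\<close>

lemma exists_line_containing_no_image:
  fixes m :: "'b \<Rightarrow> 'b \<Rightarrow> 'b"
  assumes lin1: "\<And>x. Vector_Spaces.linear scale scale (m x)"
    and lin2: "\<And>y. Vector_Spaces.linear scale scale (\<lambda>x. m x y)"
    and X: "has_vdim X a" and Y: "has_vdim Y b" and Z: "has_vdim Z t"
    and mZ: "\<And>x y. x \<in> X \<Longrightarrow> y \<in> Y \<Longrightarrow> m x y \<in> Z"
    and nd1: "\<And>x. x \<in> X \<Longrightarrow> (\<forall>y\<in>Y. m x y = 0) \<Longrightarrow> x = 0"
    and nd2: "\<And>y. y \<in> Y \<Longrightarrow> (\<forall>x\<in>X. m x y = 0) \<Longrightarrow> y = 0"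
    and t: "t \<ge> 1" and ineq: "t * b + 1 < a + t * t"
  shows "\<exists>z\<in>Z. z \<noteq> 0 \<and> (\<forall>y\<in>Y. (\<forall>x\<in>X. m x y \<in> span {z}) \<longrightarrow> y = 0)"
proof (rule ccontr)
  assume "\<not> ?thesis"
  then have "\<forall>z\<in>Z. \<exists>y. z \<noteq> 0 \<longrightarrow> y \<in> Y \<and> y \<noteq> 0 \<and> (\<forall>x\<in>X. m x y \<in> span {z})" by blast
  then obtain u where u: "\<And>z. z \<in> Z \<Longrightarrow> z \<noteq> 0 \<Longrightarrow> u z \<in> Y"
      "\<And>z. z \<in> Z \<Longrightarrow> z \<noteq> 0 \<Longrightarrow> u z \<noteq> 0"
      "\<And>z x. z \<in> Z \<Longrightarrow> z \<noteq> 0 \<Longrightarrow> x \<in> X \<Longrightarrow> m x (u z) \<in> span {z}"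
    by metis
  interpret m: module_hom scale scale "m x" for x
    using lin1 by (simp add: module_hom_iff_linear)
  interpret m2: module_hom scale scale "\<lambda>x. m x y" for y
    using lin2 by (simp add: module_hom_iff_linear)
  obtain A where A: "finite A" "independent A" "card A = a" "span A = X"
    using X by (auto simp: has_vdim_def)
  obtain V where V: "finite V" "independent V" "card V = t" "span V = Z"
    using Z by (auto simp: has_vdim_def)
  have VZ: "v \<in> Z" "v \<noteq> 0" if "v \<in> V" for v
    using that V dependent_zero[of V] span_base[of v V] by auto
  have "\<forall>v\<in>V. \<forall>x\<in>X. \<exists>k. m x (u v) = k *s v"
    using u(3) VZ by (fastforce simp: span_singleton)
  \<comment> \<open>\<open>l v\<close> is the linear form on \<open>X\<close> describing
    multiplication by the bad element \<open>u v\<close>, whose values all lie on the line of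
    \<open>v\<close>.\<close>
  then obtain l where l: "\<And>v x. v \<in> V \<Longrightarrow> x \<in> X \<Longrightarrow> m x (u v) = l v x *s v" by metis
  have msum: "m x (\<Sum>v\<in>V. c v *s u v) = (\<Sum>v\<in>V. (c v * l v x) *s v)" if "x \<in> X" for c x
    using that l by (simp add: m.sum m.scale scale_scale)
  have ln: "\<exists>x\<in>X. l v x \<noteq> 0" if "v \<in> V" for v
    using nd2[of "u v"] u(1,2) VZ[OF that] l[OF that] by fastforce
  \<comment> \<open>Multiplying a relation by \<open>x\<close> gives a relation among the basis
    vectors \<open>v\<close>, so each \<open>c v * l v x\<close> vanishes, while no
    \<open>l v\<close> is identically zero on \<open>X\<close>.\<close>
  have fam0: "\<forall>v\<in>V. c v = 0" if c: "(\<Sum>v\<in>V. c v *s u v) = 0" for c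
  proof -
    have "c v * l v x = 0" if "x \<in> X" "v \<in> V" for v x
      using msum[OF that(1), of c] c independentD[OF V(2,1), of "\<lambda>v. c v * l v x"] that(2) by simp
    then show ?thesis using ln by fastforce
  qed
  note fam = independent_family[OF V(1) fam0]
  \<comment> \<open>The dimension count common to both cases. When \<open>T\<close> is completed to
    a basis of \<open>Y\<close>, each new vector imposes at most \<open>t\<close> conditions on
    \<open>x\<close>, each vector of \<open>S\<close> at most one since its products lie on a line,
    and the rest of \<open>T\<close> none by \<open>van\<close>. Fewer than \<open>a\<close>
    conditions leave a nonzero \<open>x\<close> annihilating \<open>Y\<close>, against
    \<open>nd1\<close>.\<close>
  have key: False
    if T: "T \<subseteq> Y" "independent T" and S: "S \<subseteq> T"
      and line: "\<And>y. y \<in> S \<Longrightarrow> \<exists>z. \<forall>x\<in>X. m x y \<in> span {z}"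
      and van: "\<And>x y. x \<in> X \<Longrightarrow> (\<forall>y\<in>S. m x y = 0) \<Longrightarrow> y \<in> T \<Longrightarrow> m x y = 0"
      and card: "t * (b - card T) + card S < a" for S T
  proof -
    obtain C where C: "T \<subseteq> C" "finite C" "independent C" "card C = b" "span C = Y"
      using has_vdim_extend[OF Y T(2,1)] by metis
    obtain g where g: "\<And>y x. y \<in> S \<Longrightarrow> x \<in> X \<Longrightarrow> m x y \<in> span {g y}"
      using line by metis
    define G where "G y = (if y \<in> S then {g y} else V)" for y
    have fin: "finite S" "finite T" using finite_subset[OF C(1,2)] finite_subset[OF S] by auto
    have CY: "c \<in> Y" if "c \<in> C" for c using that C(5) span_base by blast
    have "(\<Sum>c\<in>(C - T) \<union> S. card (G c)) = (\<Sum>c\<in>C - T. card (G c)) + (\<Sum>c\<in>S. card (G c))"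
      using C fin S by (intro sum.union_disjoint) auto
    also have "(\<Sum>c\<in>C - T. card (G c)) = (\<Sum>c\<in>C - T. t)"
      using S by (intro sum.cong) (auto simp: G_def V)
    also have "(\<Sum>c\<in>S. card (G c)) = (\<Sum>c\<in>S. 1)"
      by (intro sum.cong) (auto simp: G_def)
    also have "(\<Sum>c\<in>C - T. t) + (\<Sum>c\<in>S. 1) = t * (b - card T) + card S"
      using C fin by (simp add: card_Diff_subset)
    finally have "(\<Sum>c\<in>(C - T) \<union> S. card (G c)) < card A" using card A by simp
    moreover have "finite (G c) \<and> (\<lambda>x. m x c) ` span A \<subseteq> span (G c)"
      if "c \<in> (C - T) \<union> S" for c
      using that g mZ CY A(4) V S unfolding G_def by auto
    ultimately obtain x where x: "x \<in> X" "x \<noteq> 0" "\<forall>c\<in>(C - T) \<union> S. m x c = 0"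
      using common_kernel_nonzero[of "(C - T) \<union> S" "\<lambda>c x. m x c" G A] lin2 A C fin by auto
    have "m x c = 0" if "c \<in> C" for c using that x van by blast
    then have "m x y = 0" if "y \<in> Y" for y using m.eq_0_on_span[of C x y] that C(5) by auto
    then show False using nd1 x by blast
  qed
  \<comment> \<open>All coordinates of \<open>w\<close> in the basis \<open>V\<close> are 1, so if
    \<open>u w\<close> depends on the elements \<open>u v\<close>, it ties all the forms
    \<open>l v\<close> together.\<close>
  define w where "w = \<Sum>V"
  have wZ: "w \<in> Z" unfolding w_def V(4)[symmetric] by (intro span_sum span_base)
  obtain v where v: "v \<in> V" using V(1,3) t by fastforce
  have w0: "w \<noteq> 0"
    using independentD[OF V(2,1) subset_refl, of "\<lambda>_. 1" v] v unfolding w_def by auto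
  have uY: "u ` V \<subseteq> Y" using u(1) VZ by blast
  have cardT: "card (u ` V) = t" using card_image[OF fam(1)] V by simp
  have tb: "t \<le> b" using has_vdim_independent_le(2)[OF Y fam(2) uY] cardT by simp
  show False
  proof (cases "u w \<in> span (u ` V)")
    \<comment> \<open>Here \<open>S = T\<close> has \<open>t + 1\<close> elements, and the count is
      \<open>t * (b - t - 1) + t + 1 = t * b - t * t + 1\<close>.\<close>
    case False
    have ind: "independent (insert (u w) (u ` V))" using independent_insertI[OF False fam(2)] .
    have sub: "insert (u w) (u ` V) \<subseteq> Y" using uY u(1)[OF wZ w0] by auto
    have "u w \<notin> u ` V" using False span_base by blast
    then have card: "card (insert (u w) (u ` V)) = Suc t" using cardT V by simp
    have "Suc t \<le> b" using has_vdim_independent_le(2)[OF Y ind sub] card by simp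
    then obtain d where d: "b = Suc t + d" by (auto simp: le_iff_add)
    show False
    proof (rule key[OF sub ind subset_refl])
      show "\<exists>z. \<forall>x\<in>X. m x y \<in> span {z}" if "y \<in> insert (u w) (u ` V)" for y
        using that u(3) wZ w0 VZ by blast
      show "t * (b - card (insert (u w) (u ` V))) + card (insert (u w) (u ` V)) < a"
        using ineq unfolding card d by (simp add: algebra_simps)
    qed blast
  next
    case True
    obtain c where c: "u w = (\<Sum>v\<in>V. c v *s u v)"
      using span_image_finite[OF V(1) True fam(1)] by blast
    \<comment> \<open>\<open>m x (u w)\<close> is a multiple of the sum of the basis, so its
      coordinates \<open>c v * l v x\<close> do not depend on \<open>v\<close>.\<close>
    have cl: "\<exists>k. \<forall>v\<in>V. c v * l v x = k" if x: "x \<in> X" for x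
    proof -
      obtain k where k: "m x (u w) = k *s w"
        using u(3)[OF wZ w0 x] by (auto simp: span_singleton)
      have "(\<Sum>v\<in>V. (c v * l v x - k) *s v) = 0"
        using k msum[OF x, of c] unfolding c
        by (simp add: scale_left_diff_distrib sum_subtractf w_def scale_sum_right)
      then have "\<forall>v\<in>V. c v * l v x - k = 0"
        using independentD[OF V(2,1) subset_refl, of "\<lambda>v. c v * l v x - k"] by blast
      then show ?thesis by auto
    qed
    obtain v0 where v0: "v0 \<in> V" "c v0 \<noteq> 0"
    proof -
      have "\<exists>v\<in>V. c v \<noteq> 0"
      proof (rule ccontr)
        assume "\<not> ?thesis"
        then have "u w = 0" unfolding c by (intro sum.neutral) auto
        then show False using u(2)[OF wZ w0] by simp
      qed
      then show ?thesis using that by blast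
    qed
    \<comment> \<open>For some \<open>x\<close> the common value \<open>c v0 * l v0 x\<close> is
      nonzero, which forces every \<open>c v\<close> to be nonzero. Hence all the forms
      \<open>l v\<close> are proportional.\<close>
    have cn: "c v \<noteq> 0" if "v \<in> V" for v
    proof -
      obtain x where x: "x \<in> X" "l v0 x \<noteq> 0" using ln[OF v0(1)] by blast
      obtain k where "\<forall>v\<in>V. c v * l v x = k" using cl[OF x(1)] by blast
      then have "c v * l v x = c v0 * l v0 x" using that v0(1) by simp
      then show ?thesis using x(2) v0(2) by auto
    qed
    obtain d where d: "b = t + d" using tb by (auto simp: le_iff_add)
    \<comment> \<open>By proportionality the single condition at \<open>u v0\<close> takes care of
      every \<open>u v\<close>. The count \<open>t * (b - t) + 1\<close> is the same bound as
      before.\<close>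
    show False
    proof (rule key[OF uY fam(2), of "{u v0}"])
      show "\<exists>z. \<forall>x\<in>X. m x y \<in> span {z}" if "y \<in> {u v0}" for y
        using that u(3) v0(1) VZ by blast
      show "m x y = 0" if x: "x \<in> X" and 0: "\<forall>y\<in>{u v0}. m x y = 0" and y: "y \<in> u ` V" for x y
      proof -
        have "l v0 x = 0" using l[OF v0(1) x] 0 VZ[OF v0(1)] by auto
        have "l v x = 0" if v: "v \<in> V" for v
        proof -
          obtain k where "\<forall>v\<in>V. c v * l v x = k" using cl[OF x] by blast
          then have "c v * l v x = c v0 * l v0 x" using v v0(1) by simp
          then show ?thesis using \<open>l v0 x = 0\<close> cn[OF v] by simp
        qed
        then show ?thesis using y l[OF _ x] by auto
      qed
      show "t * (b - card (u ` V)) + card {u v0} < a"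
        using ineq unfolding cardT d by (simp add: algebra_simps)
    qed (use v0 in auto)
  qed
qed

end

section \<open>Quotients of the polynomial ring as vector spaces\<close>

text \<open>Scaling is multiplication by a constant polynomial: the vector space laws then follow
  from the ring laws, and ideals of \<open>poly_ring r\<close> are closed under it by
  absorption.\<close>

definition poly_scale :: "'k::field \<Rightarrow> 'k mpoly \<Rightarrow> 'k mpoly"
  where "poly_scale c p = Poly_Mapping.single 0 c * p"

interpretation poly: lin_space "poly_scale :: 'k::field \<Rightarrow> 'k mpoly \<Rightarrow> 'k mpoly"
  by unfold_locales
    (auto simp: poly_scale_def algebra_simps single_add mult_single simp flip: mult.assoc)

lemma poly_scale_mult_left: "poly_scale c p * q = poly_scale c (p * q)"
  and poly_scale_mult_right: "p * poly_scale c q = poly_scale c (p * q)"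
  by (simp_all add: poly_scale_def ac_simps)

lemma lookup_poly_scale [simp]:
  "Poly_Mapping.lookup (poly_scale c p) m = c * Poly_Mapping.lookup p m"
  unfolding poly_scale_def mult_map_scale_conv_mult[symmetric]
  by (simp add: Poly_Mapping.map.rep_eq when_def)

section \<open>The polynomial ring as a carrier\<close>

lemma poly_ring_simps [simp]:
  "mult (poly_ring r) = (*)" "one (poly_ring r) = 1"
  "zero (poly_ring r) = 0" "add (poly_ring r) = (+)"
  by (simp_all add: poly_ring_def)

lemma in_poly_ring_iff:
  "p \<in> carrier (poly_ring r) \<longleftrightarrow> (\<forall>m\<in>Poly_Mapping.keys p. Poly_Mapping.keys m \<subseteq> {..<r})"
  by (simp add: poly_ring_def)

lemma poly_ring_closed [simp, intro]:
  "0 \<in> carrier (poly_ring r)" "1 \<in> carrier (poly_ring r)"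
  "Poly_Mapping.single 0 c \<in> carrier (poly_ring r)"
  by (auto simp: in_poly_ring_iff split: if_splits)

lemma poly_ring_add [simp, intro]:
  assumes "p \<in> carrier (poly_ring r)" "q \<in> carrier (poly_ring r)"
  shows "p + q \<in> carrier (poly_ring r)"
  using assms keys_add[of p q] unfolding in_poly_ring_iff by blast

lemma poly_ring_uminus [simp, intro]:
  fixes p :: "'k::field mpoly"
  assumes "p \<in> carrier (poly_ring r)"
  shows "- p \<in> carrier (poly_ring r)"
proof -
  have "Poly_Mapping.keys (- p) = Poly_Mapping.keys p" by (auto simp: in_keys_iff)
  then show ?thesis using assms by (simp add: in_poly_ring_iff)
qed

lemma poly_ring_diff [simp, intro]:
  assumes "p \<in> carrier (poly_ring r)" "q \<in> carrier (poly_ring r)"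
  shows "p - q \<in> carrier (poly_ring r)"
  using poly_ring_add[OF assms(1) poly_ring_uminus[OF assms(2)]] by simp

lemma poly_ring_mult [simp, intro]:
  assumes "p \<in> carrier (poly_ring r)" "q \<in> carrier (poly_ring r)"
  shows "p * q \<in> carrier (poly_ring r)"
  unfolding in_poly_ring_iff
proof
  fix m assume "m \<in> Poly_Mapping.keys (p * q)"
  then obtain a b where "m = a + b" "a \<in> Poly_Mapping.keys p" "b \<in> Poly_Mapping.keys q"
    using keys_mult[of p q] by blast
  then show "Poly_Mapping.keys m \<subseteq> {..<r}"
    using assms keys_add[of a b] unfolding in_poly_ring_iff by blast
qed

lemma poly_ring_scale [simp, intro]:
  "p \<in> carrier (poly_ring r) \<Longrightarrow> poly_scale c p \<in> carrier (poly_ring r)"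
  unfolding poly_scale_def by blast

lemma subspace_poly_ring: "poly.subspace (carrier (poly_ring r))"
  by (auto simp: poly.subspace_def)

lemma cring_poly_ring: "cring (poly_ring r :: 'k::field mpoly ring)"
proof (rule cringI)
  show "abelian_group (poly_ring r :: 'k mpoly ring)"
    by (rule abelian_groupI)
      (auto simp: algebra_simps intro!: bexI[of _ "- x" for x :: "'k mpoly"])
  show "Group.comm_monoid (poly_ring r :: 'k mpoly ring)"
    by (rule comm_monoidI) (auto simp: algebra_simps)
qed (auto simp: algebra_simps)

section \<open>Cosets modulo an ideal\<close>

locale poly_ideal =
  fixes r :: nat and I :: "'k::field mpoly set"
  assumes ideal: "ideal I (poly_ring r)"
begin

abbreviation "Q \<equiv> poly_ring r Quot I"

sublocale I: ideal I "poly_ring r" by (rule ideal)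

sublocale Q: ring Q by (rule I.quotient_is_ring)

lemma I_carrier: "p \<in> I \<Longrightarrow> p \<in> carrier (poly_ring r)"
  by (rule I.Icarr)

lemma I_zero [simp]: "0 \<in> I" using additive_subgroup.zero_closed[OF I.is_additive_subgroup] by simp

lemma I_add: "p \<in> I \<Longrightarrow> q \<in> I \<Longrightarrow> p + q \<in> I"
  using additive_subgroup.a_closed[OF I.is_additive_subgroup] by simp

lemma I_mult: "p \<in> I \<Longrightarrow> q \<in> carrier (poly_ring r) \<Longrightarrow> q * p \<in> I"
  using I.I_l_closed by simp

lemma I_mult': "p \<in> I \<Longrightarrow> q \<in> carrier (poly_ring r) \<Longrightarrow> p * q \<in> I"
  using I.I_r_closed by simp

lemma I_scale: "p \<in> I \<Longrightarrow> poly_scale c p \<in> I"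
  unfolding poly_scale_def by (rule I_mult) auto

lemma subspace_I: "poly.subspace I"
  by (auto simp: poly.subspace_def I_add I_scale)

lemmas I_diff = poly.subspace_diff[OF subspace_I]
lemmas I_sum = poly.subspace_sum[OF subspace_I]

lemma proj_eq: "proj r I p = (\<lambda>i. i + p) ` I"
  by (auto simp: proj_def a_r_coset_def r_coset_def)

lemma proj_eq_iff: "proj r I p = proj r I q \<longleftrightarrow> p - q \<in> I"
proof
  assume "proj r I p = proj r I q"
  moreover have "p \<in> proj r I p" unfolding proj_eq using I_zero by force
  ultimately show "p - q \<in> I" unfolding proj_eq by auto
next
  assume *: "p - q \<in> I"
  have "i + p \<in> (\<lambda>i. i + q) ` I" if "i \<in> I" for i
    using I_add[OF that *] by (intro image_eqI[of _ _ "i + (p - q)"]) auto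
  moreover have "i + q \<in> (\<lambda>i. i + p) ` I" if "i \<in> I" for i
    using I_diff[OF that *] by (intro image_eqI[of _ _ "i - (p - q)"]) auto
  ultimately show "proj r I p = proj r I q" unfolding proj_eq by auto
qed

lemma carrier_Q: "carrier Q = proj r I ` carrier (poly_ring r)"
  by (auto simp: FactRing_def A_RCOSETS_def RCOSETS_def proj_def a_r_coset_def)

lemma zero_Q: "\<zero>\<^bsub>Q\<^esub> = proj r I 0"
  by (auto simp: FactRing_def proj_eq)

lemma add_Q: "proj r I p \<oplus>\<^bsub>Q\<^esub> proj r I q = proj r I (p + q)"
proof -
  have "i + p + (j + q) \<in> (\<lambda>i. i + (p + q)) ` I" if "i \<in> I" "j \<in> I" for i j
    using I_add[OF that] by (intro image_eqI[of _ _ "i + j"]) (auto simp: algebra_simps)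
  moreover have "\<exists>j\<in>I. \<exists>k\<in>I. i + (p + q) = j + p + (k + q)" if "i \<in> I" for i
    using that I_zero by (intro bexI[of _ i] bexI[of _ 0]) (auto simp: algebra_simps)
  ultimately show ?thesis
    by (auto simp: FactRing_def set_add_def set_mult_def proj_eq) 
qed

lemma mult_Q:
  assumes "p \<in> carrier (poly_ring r)" "q \<in> carrier (poly_ring r)"
  shows "proj r I p \<otimes>\<^bsub>Q\<^esub> proj r I q = proj r I (p * q)"
  using I.rcoset_mult_add[OF assms] by (simp add: FactRing_def proj_def)

text \<open>The inductive dimension predicate of the library grows by line extensions; in terms of
  representatives such a step adds the multiples of \<open>v\<close> to \<open>W\<close>.\<close>

lemma line_extension_Q:
  assumes "v \<in> carrier (poly_ring r)"
  shows "Q.line_extension (scalars r I) (proj r I v) (proj r I ` W)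
    = proj r I ` {poly_scale c v + w | c w. w \<in> W}"
proof -
  have "scalars r I #>\<^bsub>Q\<^esub> proj r I v = proj r I ` range (\<lambda>c. poly_scale c v)"
    using assms by (auto simp: r_coset_def scalars_def mult_Q poly_scale_def)
  then show ?thesis
    unfolding Q.line_extension_def set_add_def set_mult_def
    by (auto simp: add_Q)
qed

end

text \<open>\<open>\<pi>\<close> replaces cosets by polynomials: its kernel is \<open>I\<close>, so
  its values correspond to residue classes and linear algebra modulo \<open>I\<close> takes place
  among polynomials. Only the kernel is prescribed, so composing with a further linear map enlarges
  the ideal.\<close>

locale poly_quotient = poly_ideal r I for r and I :: "'k::field mpoly set" +
  fixes \<pi> :: "'k mpoly \<Rightarrow> 'k mpoly"
  assumes linear: "Vector_Spaces.linear poly_scale poly_scale \<pi>"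
    and kernel: "\<And>p. \<pi> p = 0 \<longleftrightarrow> p \<in> I"
begin

sublocale \<pi>: module_hom poly_scale poly_scale \<pi>
  using linear by (simp add: module_hom_iff_linear)

lemma proj_eq_iff_pi: "proj r I p = proj r I q \<longleftrightarrow> \<pi> p = \<pi> q"
  using kernel[of "p - q"] by (simp add: proj_eq_iff \<pi>.diff)

lemma proj_image_eq_iff_pi: "proj r I ` V = proj r I ` W \<longleftrightarrow> \<pi> ` V = \<pi> ` W"
proof -
  have *: "proj r I ` V \<subseteq> proj r I ` W \<longleftrightarrow> \<pi> ` V \<subseteq> \<pi> ` W" for V W
    by (simp add: image_subset_iff) (simp add: image_iff proj_eq_iff_pi)
  show ?thesis by (simp only: set_eq_subset *)
qed

text \<open>Induction along the derivation of the dimension: the vector added in each step lies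
  outside the previous subspace, so its image under \<open>\<pi>\<close> enlarges the basis.\<close>

lemma dimension_imp_has_vdim:
  assumes "Q.dimension n (scalars r I) V"
  shows "\<exists>W \<subseteq> carrier (poly_ring r). V = proj r I ` W \<and> poly.has_vdim (\<pi> ` W) n"
  using assms
proof (induction n "scalars r I" V rule: Q.dimension.induct)
  case zero_dim
  show ?case
    using poly.independent_empty
    by (intro exI[of _ "{0}"]) (auto simp: zero_Q poly.has_vdim_def intro!: exI[of _ "{}"])
next
  case (Suc_dim v E n)
  then obtain W where W: "W \<subseteq> carrier (poly_ring r)" "E = proj r I ` W" "poly.has_vdim (\<pi> ` W) n"
    by auto
  obtain B where B: "finite B" "poly.independent B" "card B = n" "poly.span B = \<pi> ` W"
    using W(3) by (auto simp: poly.has_vdim_def)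
  obtain u where u: "u \<in> carrier (poly_ring r)" "v = proj r I u"
    using Suc_dim(1) by (auto simp: carrier_Q)
  define W' where "W' = {poly_scale c u + w | c w. w \<in> W}"
  have nin: "\<pi> u \<notin> poly.span B"
    using Suc_dim(2) u(2) W(2) proj_eq_iff_pi unfolding B(4) by auto
  have "\<pi> ` W' = poly.span (insert (\<pi> u) B)"
  proof -
    have "x \<in> poly.span (insert (\<pi> u) B)" if x: "x \<in> \<pi> ` W'" for x
    proof -
      obtain c w where cw: "x = \<pi> (poly_scale c u + w)" "w \<in> W" using x by (auto simp: W'_def)
      then have "x - poly_scale c (\<pi> u) \<in> poly.span B" by (simp add: \<pi>.add \<pi>.scale B(4))
      then show ?thesis unfolding poly.span_breakdown_eq by blast
    qed
    moreover have "x \<in> \<pi> ` W'" if x: "x \<in> poly.span (insert (\<pi> u) B)" for x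
    proof -
      obtain c w where cw: "x - poly_scale c (\<pi> u) = \<pi> w" "w \<in> W"
        using x unfolding poly.span_breakdown_eq B(4) by blast
      then have "x = \<pi> (poly_scale c u + w)" by (simp add: \<pi>.add \<pi>.scale algebra_simps)
      then show ?thesis using cw(2) unfolding W'_def by blast
    qed
    ultimately show ?thesis by blast
  qed
  moreover have "card (insert (\<pi> u) B) = Suc n"
    using card_insert_disjoint[OF B(1), of "\<pi> u"] B(3) nin poly.span_base[of "\<pi> u" B] by metis
  ultimately have "poly.has_vdim (\<pi> ` W') (Suc n)"
    using B(1,2) poly.independent_insertI[OF nin] unfolding poly.has_vdim_def by blast
  moreover have "W' \<subseteq> carrier (poly_ring r)" using W(1) u(1) by (auto simp: W'_def)
  ultimately show ?case
    using line_extension_Q[OF u(1), of W] unfolding W'_def u(2) W(2) by blast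
qed

text \<open>The converse direction, building the subspace from a basis one line at a time.
  Representatives form the full preimage in the ring, so that a line extension is again of this
  form.\<close>

lemma dimension_of_span:
  assumes "finite B" "poly.independent B" "B \<subseteq> \<pi> ` carrier (poly_ring r)"
  shows "Q.dimension (card B) (scalars r I)
    (proj r I ` {p \<in> carrier (poly_ring r). \<pi> p \<in> poly.span B})"
  using assms
proof (induction B rule: finite_induct)
  case empty
  have "proj r I ` {p \<in> carrier (poly_ring r). \<pi> p \<in> poly.span {}} = proj r I ` {0}"
    unfolding proj_image_eq_iff_pi by force
  then show ?case by (simp flip: zero_Q)
next
  case (insert b B)
  let ?W = "{p \<in> carrier (poly_ring r). \<pi> p \<in> poly.span B}"
  obtain v where v: "v \<in> carrier (poly_ring r)" "b = \<pi> v" using insert.prems(2) by auto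
  have ind: "poly.independent B" "b \<notin> poly.span B"
    using insert.prems(1) insert.hyps(2) by (auto simp: poly.independent_insert)
  have IH: "Q.dimension (card B) (scalars r I) (proj r I ` ?W)"
    using insert ind by auto
  have "proj r I v \<notin> proj r I ` ?W"
    using ind(2) v(2) proj_eq_iff_pi by auto
  then have "Q.dimension (Suc (card B)) (scalars r I)
      (Q.line_extension (scalars r I) (proj r I v) (proj r I ` ?W))"
    using v(1) carrier_Q by (intro Q.Suc_dim IH) auto
  moreover have "{poly_scale c v + w | c w. w \<in> ?W}
      = {p \<in> carrier (poly_ring r). \<pi> p \<in> poly.span (insert b B)}" (is "?L = ?R")
  proof -
    have "x \<in> ?R" if x: "x \<in> ?L" for x
    proof -
      obtain c w where cw: "x = poly_scale c v + w" "w \<in> ?W" using x by blast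
      then have "\<pi> x - poly_scale c b \<in> poly.span B" by (simp add: \<pi>.add \<pi>.scale v(2))
      then show ?thesis using cw v(1) unfolding poly.span_breakdown_eq by auto
    qed
    moreover have "x \<in> ?L" if x: "x \<in> ?R" for x
    proof -
      obtain c where c: "\<pi> x - poly_scale c b \<in> poly.span B"
        using x unfolding poly.span_breakdown_eq by blast
      have "x - poly_scale c v \<in> ?W" using x v c by (simp add: \<pi>.diff \<pi>.scale)
      moreover have "x = poly_scale c v + (x - poly_scale c v)" by simp
      ultimately show ?thesis by blast
    qed
    ultimately show ?thesis by blast
  qed
  moreover have "card (insert b B) = Suc (card B)" using insert.hyps by (rule card_insert_disjoint)
  ultimately show ?case unfolding line_extension_Q[OF v(1)] by (simp only:)
qed

text \<open>The bridge from dimensions in the quotient ring to \<open>has_vdim\<close>. The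
  representatives obtained from a dimension need not be \<open>W\<close>, but they have the same
  classes and hence the same image under \<open>\<pi>\<close>.\<close>

lemma has_dim_iff:
  assumes "W \<subseteq> carrier (poly_ring r)"
  shows "has_dim r I (proj r I ` W) n \<longleftrightarrow> poly.has_vdim (\<pi> ` W) n"
proof
  assume "has_dim r I (proj r I ` W) n"
  then have "Q.dimension n (scalars r I) (proj r I ` W)" by (simp only: has_dim_def)
  then obtain W' where W': "proj r I ` W = proj r I ` W'" "poly.has_vdim (\<pi> ` W') n"
    by (elim exE conjE dimension_imp_has_vdim[THEN exE]) (rule that)
  have "\<pi> ` W = \<pi> ` W'" using W'(1) by (simp only: proj_image_eq_iff_pi)
  then show "poly.has_vdim (\<pi> ` W) n" using W'(2) by (simp only:)
next
  assume "poly.has_vdim (\<pi> ` W) n"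
  then obtain B where B: "finite B" "poly.independent B" "card B = n" "poly.span B = \<pi> ` W"
    by (auto simp: poly.has_vdim_def)
  have "B \<subseteq> \<pi> ` carrier (poly_ring r)"
    using B(4) poly.span_superset[of B] assms by blast
  moreover have "proj r I ` {p \<in> carrier (poly_ring r). \<pi> p \<in> \<pi> ` W} = proj r I ` W"
    unfolding proj_image_eq_iff_pi using assms by auto
  ultimately show "has_dim r I (proj r I ` W) n"
    using dimension_of_span[OF B(1,2)] B(3,4) unfolding has_dim_def by simp
qed

text \<open>Ideals of the quotient are subspaces of a finite-dimensional space, so a descending
  chain is constant from a term of least dimension on.\<close>

lemma artinian_if_finite_dimensional:
  assumes fin: "poly.has_vdim (\<pi> ` carrier (poly_ring r)) N"
  shows "artinian_ring Q"
  unfolding artinian_ring_def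
proof (intro conjI allI impI Q.ring_axioms)
  fix J :: "nat \<Rightarrow> 'k mpoly set set"
  assume "(\<forall>n. Ideal.ideal (J n) Q) \<and> (\<forall>n. J (Suc n) \<subseteq> J n)"
  then have J: "\<And>n. Ideal.ideal (J n) Q" and dec: "\<And>n. J (Suc n) \<subseteq> J n" by auto
  define L where "L n = {p \<in> carrier (poly_ring r). proj r I p \<in> J n}" for n
  have JL: "J n = proj r I ` L n" for n
  proof -
    have "J n \<subseteq> proj r I ` carrier (poly_ring r)"
      using additive_subgroup.a_subset[OF ideal.axioms(1)[OF J[of n]]] by (simp only: carrier_Q)
    then show ?thesis unfolding L_def by blast
  qed
  have sub: "poly.subspace (\<pi> ` L n)" for n
  proof (rule \<pi>.subspace_image)
    interpret Jn: Ideal.ideal "J n" Q by (rule J)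
    \<comment> \<open>Scalars act through the classes of constant polynomials, so an ideal of
      \<open>Q\<close> absorbs them.\<close>
    have "poly_scale c p \<in> L n" if "p \<in> L n" for c p
    proof -
      have "proj r I (Poly_Mapping.single 0 c) \<in> carrier Q" unfolding carrier_Q by blast
      with Jn.I_l_closed[of "proj r I p" "proj r I (Poly_Mapping.single 0 c)"] that
      have "proj r I (Poly_Mapping.single 0 c) \<otimes>\<^bsub>Q\<^esub> proj r I p \<in> J n"
        unfolding L_def by blast
      then show ?thesis using that mult_Q[of "Poly_Mapping.single 0 c" p]
        unfolding L_def poly_scale_def by auto
    qed
    moreover have "p + q \<in> L n" if "p \<in> L n" "q \<in> L n" for p q
      using that additive_subgroup.a_closed[OF Jn.is_additive_subgroup, of "proj r I p" "proj r I q"]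
      by (auto simp: L_def add_Q)
    moreover have "0 \<in> L n"
      using additive_subgroup.zero_closed[OF Jn.is_additive_subgroup] by (auto simp: L_def zero_Q)
    ultimately show "poly.subspace (L n)" by (auto simp: poly.subspace_def)
  qed
  have "\<exists>m. poly.has_vdim (\<pi> ` L n) m" for n
    using poly.has_vdim_subspace_le[OF sub _ fin, of n] by (auto simp: L_def)
  then obtain d where d: "\<And>n. poly.has_vdim (\<pi> ` L n) (d n)" by metis
  obtain N where N: "\<And>n. d N \<le> d n"
    using ex_has_least_nat[of "\<lambda>_. True" 0 d] by auto
  have "J n = J N" if "N \<le> n" for n
  proof -
    have "J n \<subseteq> J N" using lift_Suc_antimono_le[of J, OF dec that] .
    then have le: "\<pi> ` L n \<subseteq> \<pi> ` L N" by (auto simp: L_def)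
    obtain m where m: "m \<le> d N" "poly.has_vdim (\<pi> ` L n) m" "m = d N \<longrightarrow> \<pi> ` L n = \<pi> ` L N"
      using poly.has_vdim_subspace_le[OF sub le d] by blast
    have "m = d n" using poly.has_vdim_unique[OF m(2) d] .
    then have "\<pi> ` L n = \<pi> ` L N" using m N[of n] by auto
    then show ?thesis unfolding JL proj_image_eq_iff_pi .
  qed
  then show "\<exists>N. \<forall>n\<ge>N. J n = J N" by blast
qed

end

section \<open>Graded pieces and level algebras\<close>

lemma mon_deg_add: "mon_deg (a + b) = mon_deg a + mon_deg b"
  unfolding mon_deg_def by (rule setsum_keys_plus_distrib) auto

lemma mon_deg_zero [simp]: "mon_deg 0 = 0"
  by (simp add: mon_deg_def)

lemma mon_deg_eq_0_iff [simp]: "mon_deg m = 0 \<longleftrightarrow> m = 0"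
proof
  assume "mon_deg m = 0"
  then have "\<forall>j\<in>Poly_Mapping.keys m. Poly_Mapping.lookup m j = 0" by (simp add: mon_deg_def)
  then show "m = 0" by (intro poly_mapping_eqI) (auto simp: in_keys_iff)
qed (simp add: mon_deg_def)

lemma mon_deg_single [simp]: "mon_deg (Poly_Mapping.single j n) = n"
  by (simp add: mon_deg_def)

lemma monomial_split:
  fixes m :: "nat \<Rightarrow>\<^sub>0 nat"
  assumes "m \<noteq> 0"
  obtains j m' where "j \<in> Poly_Mapping.keys m" "m = Poly_Mapping.single j 1 + m'"
    "Poly_Mapping.keys m' \<subseteq> Poly_Mapping.keys m"
proof -
  obtain j where j: "j \<in> Poly_Mapping.keys m" using assms by fastforce
  let ?m' = "m - Poly_Mapping.single j 1"
  have "m = Poly_Mapping.single j 1 + ?m'"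
    using j by (intro poly_mapping_eqI)
      (auto simp: lookup_add lookup_minus lookup_single in_keys_iff when_def)
  moreover have "Poly_Mapping.keys ?m' \<subseteq> Poly_Mapping.keys m"
    by (auto simp: in_keys_iff lookup_minus)
  ultimately show ?thesis using that j by blast
qed

definition poly_var :: "nat \<Rightarrow> 'k::field mpoly"
  where "poly_var j = Poly_Mapping.single (Poly_Mapping.single j 1) 1"

lemma poly_sum_monomials:
  "p = (\<Sum>m\<in>Poly_Mapping.keys p. Poly_Mapping.single m (Poly_Mapping.lookup p m))"
  by (intro poly_mapping_eqI)
    (auto simp: lookup_sum lookup_single when_def in_keys_iff sum.delta)

lemma lookup_hom_component:
  "Poly_Mapping.lookup (hom_component d p) m
    = (if mon_deg m = d then Poly_Mapping.lookup p m else 0)"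
  by (auto simp: hom_component_def lookup_mapp when_def in_keys_iff)

lemma linear_hom_component:
  "module_hom poly_scale poly_scale (hom_component d)"
  by unfold_locales
    (auto intro!: poly_mapping_eqI simp: lookup_hom_component lookup_add)

interpretation hom_component: module_hom poly_scale poly_scale "hom_component d"
  for d by (rule linear_hom_component)

lemma hom_component_forms [simp, intro]:
  "p \<in> carrier (poly_ring r) \<Longrightarrow> hom_component d p \<in> forms r d"
  unfolding forms_def in_poly_ring_iff
  by (auto simp: in_keys_iff lookup_hom_component split: if_splits)

lemma hom_component_of_form:
  "p \<in> forms r i \<Longrightarrow> hom_component d p = (if d = i then p else 0)"
  by (auto simp: forms_def lookup_hom_component in_keys_iff intro!: poly_mapping_eqI)

lemma sum_hom_component: "\<exists>D. p = (\<Sum>d\<le>D. hom_component d p)"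
proof -
  obtain D where D: "\<forall>m\<in>Poly_Mapping.keys p. mon_deg m \<le> D"
    using finite_nat_set_iff_bounded_le[of "mon_deg ` Poly_Mapping.keys p"] by auto
  have "p = (\<Sum>d\<le>D. hom_component d p)"
    using D by (intro poly_mapping_eqI)
      (auto simp: lookup_sum lookup_hom_component in_keys_iff sum.delta' dest!: bspec)
  then show ?thesis by blast
qed

lemma forms_carrier: "p \<in> forms r d \<Longrightarrow> p \<in> carrier (poly_ring r)"
  by (simp add: forms_def)

lemma forms_subset: "forms r d \<subseteq> carrier (poly_ring r)"
  by (auto simp: forms_def)

lemma subspace_forms: "poly.subspace (forms r d)"
proof -
  \<comment> \<open>Forms are the fixed points in the ring of a linear map, so the subspace laws
    follow from linearity.\<close>
  have eq: "forms r d = {p \<in> carrier (poly_ring r). hom_component d p = (p :: 'k::field mpoly)}"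
  proof (intro equalityI subsetI)
    show "p \<in> {p \<in> carrier (poly_ring r). hom_component d p = p}" if "p \<in> forms r d" for p :: "'k mpoly"
      using that hom_component_of_form[OF that, of d] by (simp add: forms_def)
    show "p \<in> forms r d" if "p \<in> {p \<in> carrier (poly_ring r). hom_component d p = p}" for p :: "'k mpoly"
      using that hom_component_forms[of p r d] by auto
  qed
  show ?thesis
    unfolding eq poly.subspace_def
    by (auto simp: hom_component.add hom_component.scale)
qed

lemma forms_mult:
  assumes "p \<in> forms r i" "q \<in> forms r j"
  shows "p * q \<in> forms r (i + j)"
proof -
  have "mon_deg m = i + j" if m: "m \<in> Poly_Mapping.keys (p * q)" for m
  proof -
    obtain a b where "m = a + b" "a \<in> Poly_Mapping.keys p" "b \<in> Poly_Mapping.keys q"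
      using m keys_mult[of p q] by blast
    then show ?thesis using assms by (simp add: forms_def mon_deg_add)
  qed
  then show ?thesis using assms unfolding forms_def by blast
qed

text \<open>A form of degree \<open>k\<close> shifts all degrees by \<open>k\<close>, so only one
  component of \<open>p\<close> contributes. Modulo a homogeneous ideal this passes annihilation by
  linear forms from \<open>p\<close> to its components.\<close>

lemma hom_component_mult_form:
  assumes "p \<in> carrier (poly_ring r)" "q \<in> forms r k"
  shows "hom_component (d + k) (p * q) = hom_component d p * q"
proof -
  obtain D where D: "p = (\<Sum>i\<le>D. hom_component i p)" using sum_hom_component by blast
  have mem: "hom_component i p * q \<in> forms r (i + k)" for i
    using assms by (intro forms_mult) auto
  have "p * q = (\<Sum>i\<le>D. hom_component i p * q)"
    by (subst D) (rule sum_distrib_right)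
  then have "hom_component (d + k) (p * q) = (\<Sum>i\<le>D. hom_component (d + k) (hom_component i p * q))"
    by (simp add: hom_component.sum)
  also have "\<dots> = (\<Sum>i\<le>D. if i = d then hom_component d p * q else 0)"
    by (intro sum.cong refl, subst hom_component_of_form[OF mem]) auto
  also have "\<dots> = (\<Sum>i\<le>D. if i = d then hom_component d p else 0) * q"
    by (auto simp: sum_distrib_right intro!: sum.cong)
  \<comment> \<open>Folding back into a component of the whole sum treats \<open>d \<le> D\<close>
    and \<open>d > D\<close> alike.\<close>
  also have "(\<Sum>i\<le>D. if i = d then hom_component d p else 0) = hom_component d (\<Sum>i\<le>D. hom_component i p)"
    using assms(1) unfolding hom_component.sum
    by (intro sum.cong refl) (auto simp: hom_component_of_form[of _ r] hom_component_of_form[OF hom_component_forms])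
  also have "\<dots> = hom_component d p" by (subst (2) D) (rule refl)
  finally show ?thesis .
qed

lemma poly_var_forms: "j < r \<Longrightarrow> poly_var j \<in> forms r 1"
  by (auto simp: poly_var_def forms_def in_poly_ring_iff split: if_splits)

lemma forms_0_eq: "forms r 0 = range (Poly_Mapping.single 0)"
proof -
  have "p \<in> range (Poly_Mapping.single 0)" if "p \<in> forms r 0" for p :: "'k::field mpoly"
  proof -
    have "p = Poly_Mapping.single 0 (Poly_Mapping.lookup p 0)"
      using that by (intro poly_mapping_eqI) (auto simp: forms_def in_keys_iff lookup_single when_def)
    then show ?thesis by blast
  qed
  then show ?thesis by (auto simp: forms_def split: if_splits)
qed

lemma single_0_eq: "Poly_Mapping.single 0 c = poly_scale c 1"
  by (simp add: poly_scale_def)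

lemma single_eq_iff: "Poly_Mapping.single i (Suc 0) = Poly_Mapping.single j (Suc 0) \<longleftrightarrow> i = j"
  by (metis lookup_single_eq lookup_single_not_eq Suc_neq_Zero)

lemma has_vdim_forms_0: "poly.has_vdim (forms r 0 :: 'k::field mpoly set) 1"
proof -
  have "poly.span {1} = (forms r 0 :: 'k mpoly set)"
    by (auto simp: poly.span_singleton forms_0_eq single_0_eq)
  then show ?thesis
    unfolding poly.has_vdim_def by (intro exI[of _ "{1}"]) auto
qed

text \<open>The variables form a basis: the coefficient at a variable recovers its scalar, and a
  monomial of degree 1 leaves the trivial monomial once a variable is split off.\<close>

lemma has_vdim_forms_1: "poly.has_vdim (forms r 1 :: 'k::field mpoly set) r"
proof -
  have "\<forall>i\<in>{..<r}. c i = 0" if c: "(\<Sum>i\<in>{..<r}. poly_scale (c i) (poly_var i)) = 0"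
    for c :: "nat \<Rightarrow> 'k"
  proof
    fix j assume j: "j \<in> {..<r}"
    have "0 = Poly_Mapping.lookup (\<Sum>i\<in>{..<r}. poly_scale (c i) (poly_var i)) (Poly_Mapping.single j 1)"
      unfolding c by simp
    also have "\<dots> = (\<Sum>i\<in>{..<r}. if i = j then c i else 0)"
      unfolding lookup_sum
      by (intro sum.cong) (auto simp: poly_var_def lookup_single when_def single_eq_iff)
    also have "\<dots> = c j" using j by simp
    finally show "c j = 0" by simp
  qed
  note ind = poly.independent_family[of "{..<r}" poly_var, OF finite_lessThan this]
  have "p \<in> poly.span (poly_var ` {..<r})" if p: "p \<in> forms r 1" for p :: "'k mpoly"
  proof -
    have "Poly_Mapping.single m (Poly_Mapping.lookup p m) \<in> poly.span (poly_var ` {..<r})"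
      if m: "m \<in> Poly_Mapping.keys p" for m
    proof -
      have deg: "mon_deg m = 1" and mr: "Poly_Mapping.keys m \<subseteq> {..<r}"
        using p m unfolding forms_def in_poly_ring_iff by blast+
      then have "m \<noteq> 0" by auto
      then obtain j m' where jm: "j \<in> Poly_Mapping.keys m" "m = Poly_Mapping.single j 1 + m'"
        by (rule monomial_split)
      have "m' = 0" using deg unfolding jm(2) by (simp add: mon_deg_add)
      then have "Poly_Mapping.single m (Poly_Mapping.lookup p m)
          = poly_scale (Poly_Mapping.lookup p m) (poly_var j)"
        using jm(2) by (simp add: poly_scale_def poly_var_def mult_single)
      moreover have "poly_var j \<in> poly.span (poly_var ` {..<r} :: 'k mpoly set)"
        using jm(1) mr by (intro poly.span_base) auto
      ultimately show ?thesis by (simp add: poly.span_scale)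
    qed
    then show ?thesis by (subst poly_sum_monomials) (rule poly.span_sum)
  qed
  moreover have "poly.span (poly_var ` {..<r}) \<subseteq> (forms r 1 :: 'k mpoly set)"
    using poly_var_forms by (intro poly.span_minimal subspace_forms) blast
  ultimately have "poly.span (poly_var ` {..<r}) = (forms r 1 :: 'k mpoly set)" by blast
  then show ?thesis
    using ind card_image[OF ind(1)] unfolding poly.has_vdim_def
    by (intro exI[of _ "poly_var ` {..<r}"]) auto
qed

section \<open>Ideals, h-vectors and socles through representatives\<close>

lemma ideal_poly_ringI:
  fixes J :: "'k::field mpoly set"
  assumes "J \<subseteq> carrier (poly_ring r)" "poly.subspace J"
    and "\<And>p q. p \<in> J \<Longrightarrow> q \<in> carrier (poly_ring r) \<Longrightarrow> q * p \<in> J"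
  shows "ideal J (poly_ring r)"
proof -
  interpret cring "poly_ring r :: 'k mpoly ring" by (rule cring_poly_ring)
  have neg: "\<ominus>\<^bsub>poly_ring r\<^esub> p = - p" if "p \<in> carrier (poly_ring r)" for p :: "'k mpoly"
    using that by (intro minus_equality) auto
  show ?thesis
  proof (rule idealI[OF ring_axioms])
    show "subgroup J (add_monoid (poly_ring r))"
    proof (rule add.subgroupI)
      show "J \<noteq> {}" using poly.subspace_0[OF assms(2)] by blast
      show "\<ominus>\<^bsub>poly_ring r\<^esub> p \<in> J" if "p \<in> J" for p
        using that neg[of p] poly.subspace_neg[OF assms(2), of p] assms(1) by auto
      show "p \<oplus>\<^bsub>poly_ring r\<^esub> q \<in> J" if "p \<in> J" "q \<in> J" for p q
        using that poly.subspace_add[OF assms(2), of p q] by simp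
    qed (rule assms(1))
  qed (use assms(3) in \<open>auto simp: mult.commute\<close>)
qed

lemma image_eq_singleton_iff: "W \<noteq> {} \<Longrightarrow> f ` W = {a} \<longleftrightarrow> (\<forall>w\<in>W. f w = a)"
  by auto

context poly_ideal
begin

text \<open>The second clause, that \<open>\<pi> p\<close> represents the class of \<open>p\<close>,
  makes \<open>\<pi>\<close> compatible with products of representatives.\<close>

lemma exists_quotient_map:
  "\<exists>\<pi>. poly_quotient r I \<pi> \<and> (\<forall>p. p - \<pi> p \<in> I)"
proof -
  obtain \<pi> where \<pi>: "Vector_Spaces.linear poly_scale poly_scale \<pi>" "\<forall>p. \<pi> p = 0 \<longleftrightarrow> p \<in> I"
      "\<forall>p. p - \<pi> p \<in> I"
    using poly.exists_linear_projection[OF subspace_I] by blast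
  then have "poly_quotient r I \<pi>"
    using poly_ideal_axioms by (simp add: poly_quotient_def poly_quotient_axioms_def)
  then show ?thesis using \<pi>(3) by blast
qed

lemma has_dim_unique:
  assumes "W \<subseteq> carrier (poly_ring r)" "has_dim r I (proj r I ` W) n" "has_dim r I (proj r I ` W) m"
  shows "n = m"
proof -
  obtain \<pi> where "poly_quotient r I \<pi>" using exists_quotient_map by blast
  then interpret poly_quotient r I \<pi> .
  show ?thesis using assms poly.has_vdim_unique by (simp only: has_dim_iff)
qed

lemma has_dim_0_iff:
  assumes "W \<subseteq> carrier (poly_ring r)" "W \<noteq> {}"
  shows "has_dim r I (proj r I ` W) 0 \<longleftrightarrow> W \<subseteq> I"
proof -
  obtain \<pi> where "poly_quotient r I \<pi>" using exists_quotient_map by blast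
  then interpret poly_quotient r I \<pi> .
  have "\<pi> ` W = {0} \<longleftrightarrow> (\<forall>w\<in>W. \<pi> w = 0)" using image_eq_singleton_iff[OF assms(2)] .
  then show ?thesis
    by (simp only: has_dim_iff[OF assms(1)] poly.has_vdim_0_iff kernel subset_iff Ball_def)
qed

lemma has_dim_forms_0_iff: "has_dim r I (graded_component r I i) 0 \<longleftrightarrow> forms r i \<subseteq> I"
  unfolding graded_component_def
  by (rule has_dim_0_iff) (use forms_subset poly.subspace_0[OF subspace_forms] in blast)+

lemma h_vector_unique:
  "is_h_vector_of r I h \<Longrightarrow> is_h_vector_of r I h' \<Longrightarrow> h = h'"
  unfolding is_h_vector_of_def graded_component_def
  using has_dim_unique[OF forms_subset] by blast

text \<open>Each monomial of \<open>q\<close> has positive degree, hence contains a variable; the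
  remaining factor is absorbed by \<open>I\<close>.\<close>

lemma mult_in_ideal_if_vars:
  assumes p: "p \<in> carrier (poly_ring r)" and v: "\<And>j. j < r \<Longrightarrow> p * poly_var j \<in> I"
    and q: "q \<in> carrier (poly_ring r)" "Poly_Mapping.lookup q 0 = 0"
  shows "p * q \<in> I"
proof -
  have "p * Poly_Mapping.single m c \<in> I" if m: "m \<in> Poly_Mapping.keys q" for m c
  proof -
    have "m \<noteq> 0" using m q(2) by (auto simp: in_keys_iff)
    then obtain j m' where jm: "j \<in> Poly_Mapping.keys m" "m = Poly_Mapping.single j 1 + m'"
        "Poly_Mapping.keys m' \<subseteq> Poly_Mapping.keys m"
      by (rule monomial_split)
    have mr: "Poly_Mapping.keys m \<subseteq> {..<r}" using m q(1) by (simp add: in_poly_ring_iff)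
    have "Poly_Mapping.single m' c \<in> carrier (poly_ring r)"
      using mr jm(3) by (auto simp: in_poly_ring_iff split: if_splits)
    moreover have "p * poly_var j \<in> I" using v jm(1) mr by auto
    ultimately have "p * poly_var j * Poly_Mapping.single m' c \<in> I" by (rule I_mult'[rotated])
    also have "p * poly_var j * Poly_Mapping.single m' c = p * Poly_Mapping.single m c"
      unfolding jm(2) by (simp add: poly_var_def mult.assoc mult_single)
    finally show ?thesis .
  qed
  then have "(\<Sum>m\<in>Poly_Mapping.keys q. p * Poly_Mapping.single m (Poly_Mapping.lookup q m)) \<in> I"
    by (rule I_sum)
  also have "(\<Sum>m\<in>Poly_Mapping.keys q. p * Poly_Mapping.single m (Poly_Mapping.lookup q m)) = p * q"
    by (subst (3) poly_sum_monomials) (simp only: sum_distrib_left)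
  finally show ?thesis .
qed

text \<open>The maximal ideal is generated by the variables, so testing against linear forms is
  enough; conversely, linear forms have no constant term.\<close>

lemma proj_in_socle_iff:
  assumes p: "p \<in> carrier (poly_ring r)"
  shows "proj r I p \<in> socle r I \<longleftrightarrow> (\<forall>q\<in>forms r 1. p * q \<in> I)"
proof -
  have "proj r I p \<in> socle r I \<longleftrightarrow>
    (\<forall>q\<in>carrier (poly_ring r). Poly_Mapping.lookup q 0 = 0 \<longrightarrow> p * q \<in> I)"
    using p by (auto simp: socle_def hom_maximal_ideal_def carrier_Q mult_Q zero_Q proj_eq_iff)
  also have "\<dots> \<longleftrightarrow> (\<forall>q\<in>forms r 1. p * q \<in> I)"
  proof (intro iffI ballI impI)
    fix q :: "'k mpoly" assume *: "\<forall>q\<in>carrier (poly_ring r). Poly_Mapping.lookup q 0 = 0 \<longrightarrow> p * q \<in> I"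
      and q: "q \<in> forms r 1"
    have "Poly_Mapping.lookup q 0 = 0"
    proof (rule ccontr)
      assume "Poly_Mapping.lookup q 0 \<noteq> 0"
      then have "0 \<in> Poly_Mapping.keys q" by (simp add: in_keys_iff)
      then have "mon_deg 0 = 1" using q unfolding forms_def by blast
      then show False by simp
    qed
    then show "p * q \<in> I" using * q forms_carrier by blast
  next
    fix q :: "'k mpoly" assume "\<forall>q\<in>forms r 1. p * q \<in> I"
      and "q \<in> carrier (poly_ring r)" "Poly_Mapping.lookup q 0 = 0"
    then show "p * q \<in> I" using mult_in_ideal_if_vars[OF p] poly_var_forms by blast
  qed
  finally show ?thesis .
qed

end

section \<open>Levelness degree by degree\<close>

lemma socle_degree_unique: "socle_degree h e \<Longrightarrow> socle_degree h e' \<Longrightarrow> e = e'"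
  unfolding socle_degree_def by (metis less_irrefl linorder_neqE_nat)

text \<open>Levelness without cosets: artinianness turns into vanishing above degree
  \<open>e\<close>, and the socle condition into the absence, below degree \<open>e\<close>, of
  nonzero classes killed by all linear forms.\<close>

definition level_data :: "nat \<Rightarrow> 'k::field mpoly set \<Rightarrow> (nat \<Rightarrow> nat) \<Rightarrow> nat \<Rightarrow> bool"
  where "level_data r I h e \<longleftrightarrow> homogeneous_ideal r I \<and> 1 \<notin> I \<and> I \<inter> forms r 1 = {0} \<and>
    (\<forall>i>e. forms r i \<subseteq> I) \<and> is_h_vector_of r I h \<and> h e > 0 \<and>
    (\<forall>i<e. \<forall>p\<in>forms r i. (\<forall>q\<in>forms r 1. p * q \<in> I) \<longrightarrow> p \<in> I)"

lemma level_h_vector_imp_level_data: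
  assumes "level_h_vector TYPE('k::field) h" "socle_degree h e"
  shows "\<exists>r (I :: 'k mpoly set). level_data r I h e"
proof -
  obtain r and I :: "'k mpoly set" and t where std: "standard_graded_artinian r I"
    and hv: "is_h_vector_of r I h" and lev: "level_of_type r I t"
    using assms(1) unfolding level_h_vector_def by blast
  have hom: "homogeneous_ideal r I" and neq: "I \<noteq> carrier (poly_ring r)"
    and lin: "I \<inter> forms r 1 = {0}"
    using std by (auto simp: standard_graded_artinian_def)
  interpret poly_ideal r I using hom by (simp add: poly_ideal_def homogeneous_ideal_def)
  obtain h' e' where h': "is_h_vector_of r I h'" "socle_degree h' e'"
      "socle r I \<subseteq> graded_component r I e'"
    using lev unfolding level_of_type_def by blast
  \<comment> \<open>\<open>level_of_type\<close> brings its own h-vector and socle degree;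
    uniqueness identifies them with \<open>h\<close> and \<open>e\<close>.\<close>
  have "h' = h" using h_vector_unique[OF h'(1) hv] .
  then have "e' = e" using socle_degree_unique h'(2) assms(2) by blast
  have one: "1 \<notin> I"
  proof
    assume "1 \<in> I"
    then have "p \<in> I" if "p \<in> carrier (poly_ring r)" for p using I_mult[OF _ that, of 1] by simp
    then show False using neq I_carrier by blast
  qed
  have "forms r i \<subseteq> I" if "i > e" for i
  proof -
    have "h i = 0" using assms(2) that by (simp add: socle_degree_def)
    then have "has_dim r I (graded_component r I i) 0" using hv unfolding is_h_vector_of_def by metis
    then show ?thesis by (simp only: has_dim_forms_0_iff)
  qed
  moreover have "p \<in> I" if i: "i < e" and p: "p \<in> forms r i" and pq: "\<forall>q\<in>forms r 1. p * q \<in> I" for i p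
  proof -
    have "proj r I p \<in> graded_component r I e"
      using proj_in_socle_iff[OF forms_carrier[OF p]] pq h'(3) \<open>e' = e\<close> by blast
    then obtain g where g: "g \<in> forms r e" "p - g \<in> I"
      unfolding graded_component_def by (auto simp: proj_eq_iff)
    \<comment> \<open>A form \<open>p\<close> of degree \<open>i < e\<close> in the socle is
      congruent to a form \<open>g\<close> of degree \<open>e\<close>; the component of degree
      \<open>i\<close> of the difference is \<open>p\<close> itself.\<close>
    then have "hom_component i (p - g) \<in> I" using hom unfolding homogeneous_ideal_def by blast
    then show ?thesis
      using i by (simp add: hom_component.diff hom_component_of_form[OF p] hom_component_of_form[OF g(1)])
  qed
  moreover have "h e > 0" using assms(2) by (simp add: socle_degree_def)
  ultimately have "level_data r I h e"
    unfolding level_data_def using hom one lin hv by blast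
  then show ?thesis by blast
qed

text \<open>The pieces up to degree \<open>e\<close> span the quotient, which gives artinianness.
  The components of a socle element are killed by linear forms modulo \<open>I\<close>, so those of
  degree other than \<open>e\<close> vanish; all of degree \<open>e\<close> is in the socle because
  degree \<open>e + 1\<close> vanishes.\<close>

lemma level_data_imp_level_h_vector:
  fixes I :: "'k::field mpoly set"
  assumes "level_data r I h e"
  shows "level_h_vector TYPE('k) h"
proof -
  have hom: "homogeneous_ideal r I" and one: "1 \<notin> I" and lin: "I \<inter> forms r 1 = {0}"
    and high: "\<And>i. i > e \<Longrightarrow> forms r i \<subseteq> I" and hv: "is_h_vector_of r I h" and pos: "h e > 0"
    and lev: "\<And>i p. i < e \<Longrightarrow> p \<in> forms r i \<Longrightarrow> \<forall>q\<in>forms r 1. p * q \<in> I \<Longrightarrow> p \<in> I"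
    using assms unfolding level_data_def by auto
  interpret poly_ideal r I using hom by (simp add: poly_ideal_def homogeneous_ideal_def)
  have homI: "hom_component d p \<in> I" if "p \<in> I" for d p
    using that hom by (simp add: homogeneous_ideal_def)
  obtain \<pi> where "poly_quotient r I \<pi>" using exists_quotient_map by blast
  then interpret poly_quotient r I \<pi> .
  have vd: "poly.has_vdim (\<pi> ` forms r i) (h i)" for i
    using hv has_dim_iff[OF forms_subset] unfolding is_h_vector_of_def graded_component_def by blast
  then obtain B where B: "\<And>i. finite (B i)" "\<And>i. poly.span (B i) = \<pi> ` forms r i"
    unfolding poly.has_vdim_def by metis
  define F where "F = (\<Union>i\<le>e. B i)"
  have "\<pi> p \<in> poly.span F" if p: "p \<in> carrier (poly_ring r)" for p
  proof -
    obtain D where D: "p = (\<Sum>d\<le>D. hom_component d p)" using sum_hom_component by blast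
    have "\<pi> (hom_component d p) \<in> poly.span F" for d
    proof (cases "d \<le> e")
      case True
      then have "B d \<subseteq> F" by (auto simp: F_def)
      then show ?thesis using poly.span_mono[of "B d" F] B(2)[of d] p by auto
    next
      case False
      then have "hom_component d p \<in> I" using high[of d] hom_component_forms[OF p] by auto
      then show ?thesis using kernel[of "hom_component d p"] poly.span_zero by simp
    qed
    then have "(\<Sum>d\<le>D. \<pi> (hom_component d p)) \<in> poly.span F" by (intro poly.span_sum)
    then show ?thesis by (subst D) (simp only: \<pi>.sum)
  qed
  then have "\<pi> ` carrier (poly_ring r) \<subseteq> poly.span F" by blast
  moreover have "finite F" using B(1) by (simp add: F_def)
  ultimately obtain N where "poly.has_vdim (\<pi> ` carrier (poly_ring r)) N"
    using poly.has_vdim_if_spanned[OF \<pi>.subspace_image[OF subspace_poly_ring]] by blast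
  then have "artinian_ring Q" by (rule artinian_if_finite_dimensional)
  then have std: "standard_graded_artinian r I"
    unfolding standard_graded_artinian_def using hom one lin by auto
  have "a \<in> graded_component r I e" if a: "a \<in> socle r I" for a
  proof -
    obtain p where p: "p \<in> carrier (poly_ring r)" "a = proj r I p"
      using a by (auto simp: socle_def carrier_Q)
    have pq: "p * q \<in> I" if "q \<in> forms r 1" for q
      using a that proj_in_socle_iff[OF p(1)] unfolding p(2) by blast
    have comp: "hom_component d p \<in> I" if "d \<noteq> e" for d
    proof (cases "d < e")
      case True
      have "hom_component d p * q \<in> I" if "q \<in> forms r 1" for q
        using homI[OF pq[OF that], of "d + 1"] hom_component_mult_form[OF p(1) that] by metis
      then show ?thesis using lev[OF True hom_component_forms[OF p(1)]] by blast
    next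
      case False
      then show ?thesis using high[of d] hom_component_forms[OF p(1)] that by force
    qed
    obtain D where D: "p = (\<Sum>d\<le>D. hom_component d p)" using sum_hom_component by blast
    \<comment> \<open>Removing the component of degree \<open>e\<close> leaves terms in
      \<open>I\<close>. The bound \<open>D\<close> may be below \<open>e\<close>; then there is
      nothing to remove, whence the conditional.\<close>
    have "(\<Sum>d\<le>D. hom_component d p - (if d = e then hom_component e p else 0)) \<in> I"
      using comp by (intro I_sum) auto
    also have "(\<Sum>d\<le>D. hom_component d p - (if d = e then hom_component e p else 0))
        = p - (if e \<le> D then hom_component e p else 0)"
      by (subst (3) D) (simp add: sum_subtractf)
    finally have "proj r I p = proj r I (if e \<le> D then hom_component e p else 0)"
      by (simp only: proj_eq_iff)
    moreover have "(if e \<le> D then hom_component e p else 0) \<in> forms r e"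
      using p(1) poly.subspace_0[OF subspace_forms] by auto
    ultimately show ?thesis unfolding p(2) graded_component_def by blast
  qed
  moreover have "proj r I p \<in> socle r I" if p: "p \<in> forms r e" for p
    unfolding proj_in_socle_iff[OF forms_carrier[OF p]]
    using subsetD[OF high forms_mult[OF p], of 1] by simp
  ultimately have soc: "socle r I = graded_component r I e"
    unfolding graded_component_def by blast
  have "h i = 0" if "i > e" for i
  proof -
    have "has_dim r I (graded_component r I i) 0" using high[OF that] by (simp only: has_dim_forms_0_iff)
    moreover have "has_dim r I (graded_component r I i) (h i)" using hv unfolding is_h_vector_of_def by blast
    ultimately show ?thesis
      using has_dim_unique[OF forms_subset] unfolding graded_component_def by blast
  qed
  then have "socle_degree h e" using pos by (simp add: socle_degree_def)
  then have "level_of_type r I (h e)"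
    unfolding level_of_type_def using hv soc unfolding is_h_vector_of_def by (metis order_refl)
  then show ?thesis unfolding level_h_vector_def using std hv by blast
qed

section \<open>Socle degree at most one\<close>

lemma has_dim_if_forms_Int_ideal_trivial:
  fixes I :: "'k::field mpoly set"
  assumes "poly_quotient r I \<pi>" "forms r i \<inter> I \<subseteq> {0}" "poly.has_vdim (forms r i :: 'k mpoly set) n"
  shows "has_dim r I (graded_component r I i) n"
proof -
  interpret poly_quotient r I \<pi> by fact
  have "poly.has_vdim (\<pi> ` forms r i) n"
    using assms(2) by (intro poly.has_vdim_image_inj[OF linear assms(3)]) (auto simp: kernel)
  then show ?thesis unfolding graded_component_def by (simp only: has_dim_iff[OF forms_subset])
qed

text \<open>Realised by the polynomial ring in \<open>h 1\<close> variables modulo the square of its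
  maximal ideal. The case \<open>h 1 = 0\<close>, where the algebra is the field itself, is
  included; it arises from \<open>e = 1\<close> and \<open>t = 1\<close>.\<close>

lemma level_h_vector_socle_degree_le_1:
  assumes "h 0 = 1" "\<And>i. i \<ge> 2 \<Longrightarrow> h i = 0"
  shows "level_h_vector TYPE('k::field) h"
proof -
  define r where "r = h 1"
  define I :: "'k mpoly set" where
    "I = {p \<in> carrier (poly_ring r). \<forall>m\<in>Poly_Mapping.keys p. 2 \<le> mon_deg m}"
  \<comment> \<open>Without variables there is nothing in degree 1, and the socle degree drops to
    0.\<close>
  define e :: nat where "e = (if r = 0 then 0 else 1)"
  \<comment> \<open>As the common kernel of two linear maps on the ring, \<open>I\<close> is readily
    seen to be a subspace.\<close>
  have I_iff: "p \<in> I \<longleftrightarrow> p \<in> carrier (poly_ring r) \<and> hom_component 0 p = 0 \<and> hom_component 1 p = 0" for p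
  proof -
    have two: "2 \<le> n \<longleftrightarrow> n \<noteq> 0 \<and> n \<noteq> 1" for n :: nat by auto
    have zero: "hom_component d p = 0 \<longleftrightarrow> (\<forall>m\<in>Poly_Mapping.keys p. mon_deg m \<noteq> d)" for d
      unfolding poly_mapping_eq_iff fun_eq_iff lookup_hom_component Ball_def in_keys_iff by (simp, blast)
    have "(\<forall>m\<in>Poly_Mapping.keys p. 2 \<le> mon_deg m) \<longleftrightarrow>
        hom_component 0 p = 0 \<and> hom_component 1 p = 0"
      unfolding zero two by blast
    then show ?thesis by (simp add: I_def)
  qed
  have "poly.subspace I"
    unfolding poly.subspace_def Ball_def I_iff
    by (simp add: hom_component.add hom_component.scale)
  moreover have "q * p \<in> I" if p: "p \<in> I" and q: "q \<in> carrier (poly_ring r)" for p q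
  proof -
    have "2 \<le> mon_deg m" if m: "m \<in> Poly_Mapping.keys (q * p)" for m
    proof -
      obtain a b where "m = a + b" "b \<in> Poly_Mapping.keys p" using m keys_mult[of q p] by blast
      then show ?thesis using p unfolding I_def by (auto simp: mon_deg_add intro: trans_le_add2)
    qed
    then show ?thesis using p q unfolding I_def by simp
  qed
  ultimately have ideal: "ideal I (poly_ring r)" by (intro ideal_poly_ringI) (auto simp: I_def)
  interpret poly_ideal r I using ideal by (simp add: poly_ideal_def)
  obtain \<pi> where \<pi>: "poly_quotient r I \<pi>" using exists_quotient_map by blast
  have "hom_component d p \<in> I" if p: "p \<in> I" for d p
  proof -
    have "Poly_Mapping.keys (hom_component d p) \<subseteq> Poly_Mapping.keys p"
      by (auto simp: in_keys_iff lookup_hom_component split: if_splits)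
    then show ?thesis using p unfolding I_def in_poly_ring_iff by blast
  qed
  then have hom: "homogeneous_ideal r I" using ideal by (simp add: homogeneous_ideal_def)
  have low: "forms r i \<inter> I \<subseteq> {0}" if "i < 2" for i
  proof -
    have "p = 0" if "p \<in> forms r i" "p \<in> I" for p
      using that(2) hom_component_of_form[OF that(1), of i] \<open>i < 2\<close> unfolding I_iff
      by (auto simp: less_2_cases_iff)
    then show ?thesis by blast
  qed
  have low0: "forms r 0 \<inter> I \<subseteq> {0}" and low1: "forms r 1 \<inter> I \<subseteq> {0}"
    using low[of 0] low[of 1] by simp_all
  have high: "forms r i \<subseteq> I" if "i \<ge> 2" for i
  proof
    fix p :: "'k mpoly" assume "p \<in> forms r i"
    then show "p \<in> I" using that unfolding forms_def I_def by simp
  qed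
  \<comment> \<open>Without variables there are no monomials of positive degree; this settles degree
    1, which lies above \<open>e = 0\<close> here.\<close>
  have r0: "forms r i \<subseteq> I" if "r = 0" "i > 0" for i
  proof -
    have "p = 0" if p: "p \<in> forms r i" for p :: "'k mpoly"
    proof -
      have "m \<notin> Poly_Mapping.keys p" for m
      proof
        assume "m \<in> Poly_Mapping.keys p"
        then have "m = 0" "mon_deg m = i"
          using p \<open>r = 0\<close> unfolding forms_def in_poly_ring_iff by simp_all
        then show False using \<open>i > 0\<close> by simp
      qed
      then have "Poly_Mapping.keys p = {}" by blast
      then show ?thesis by simp
    qed
    then show ?thesis by (metis I_zero subsetI)
  qed
  have hv: "has_dim r I (graded_component r I i) (h i)" for i
  proof -
    consider "i = 0" | "i = 1" | "i \<ge> 2" by linarith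
    then show ?thesis
    proof cases
      case 1
      then show ?thesis
        using has_dim_if_forms_Int_ideal_trivial[OF \<pi> low0 has_vdim_forms_0] assms(1) by simp
    next
      case 2
      then show ?thesis
        using has_dim_if_forms_Int_ideal_trivial[OF \<pi> low1 has_vdim_forms_1] by (simp add: r_def)
    next
      case 3
      then show ?thesis using high[OF 3] assms(2)[OF 3] by (simp add: has_dim_forms_0_iff)
    qed
  qed
  \<comment> \<open>Only \<open>i = 0\<close> with at least one variable arises: a constant whose
    product with the first variable is in \<open>I\<close> must be 0, since \<open>I\<close>
    contains no nonzero linear form.\<close>
  have lev: "p \<in> I" if i: "i < e" and p: "p \<in> forms r i" and pq: "\<forall>q\<in>forms r 1. p * q \<in> I" for i p
  proof -
    have i0: "i = 0" and r: "r > 0" using i by (auto simp: e_def split: if_splits)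
    obtain c where c: "p = poly_scale c 1"
      using p unfolding i0 forms_0_eq single_0_eq by blast
    have x: "poly_var 0 \<in> (forms r 1 :: 'k mpoly set)" using r by (rule poly_var_forms)
    have "p * poly_var 0 \<in> I" using pq x by blast
    moreover have "p * poly_var 0 = poly_scale c (poly_var 0)" by (simp add: c poly_scale_mult_left)
    ultimately have "poly_scale c (poly_var 0) \<in> forms r 1 \<inter> I"
      using poly.subspace_scale[OF subspace_forms x] by simp
    then have "poly_scale c (poly_var 0 :: 'k mpoly) = 0" using low1 by blast
    moreover have "(poly_var 0 :: 'k mpoly) \<noteq> 0"
      unfolding poly_var_def by (metis lookup_single_eq lookup_zero zero_neq_one)
    ultimately have "c = 0" by simp
    then show ?thesis unfolding c by simp
  qed
  have one: "1 \<notin> I"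
  proof -
    have "(1 :: 'k mpoly) \<in> forms r 0" by (auto simp: forms_def)
    then show ?thesis using low0 by auto
  qed
  have "level_data r I h e"
    unfolding level_data_def
  proof (intro conjI allI impI ballI)
    show "I \<inter> forms r 1 = {0}" using low1 poly.subspace_0[OF subspace_forms] by auto
    show "forms r i \<subseteq> I" if "i > e" for i
      using that high[of i] r0[of i] by (auto simp: e_def split: if_splits)
    show "is_h_vector_of r I h" using hv by (simp add: is_h_vector_of_def)
    show "h e > 0" using assms(1) by (auto simp: e_def r_def)
  qed (use hom one lev in blast)+
  then show ?thesis by (rule level_data_imp_level_h_vector)
qed

text \<open>The ideal is enlarged to \<open>J\<close>, the sum of \<open>I\<close> and the line of
  \<open>f\<close>. Degree \<open>e + 1\<close> lies in \<open>I\<close>, so this sum is already an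
  ideal, and only degree \<open>e\<close> changes. Below degree \<open>e - 1\<close> levelness is
  inherited; in degree \<open>e - 1\<close> it is the hypothesis \<open>line\<close>.\<close>

lemma level_data_quotient_by_socle_element:
  fixes I :: "'k::field mpoly set"
  assumes data: "level_data r I h e" and e: "e \<ge> 2"
    and quot: "poly_quotient r I \<pi>" and proj: "\<And>p. p - \<pi> p \<in> I"
    and f: "f \<in> forms r e" "f \<notin> I"
    and he: "h e = Suc n" "n > 0"
    and line: "\<And>p. p \<in> forms r (e - 1) \<Longrightarrow> (\<forall>q\<in>forms r 1. \<pi> (p * q) \<in> poly.span {\<pi> f}) \<Longrightarrow> p \<in> I"
  shows "level_h_vector TYPE('k) (h(e := n))"
proof -
  interpret poly_quotient r I \<pi> by (rule quot)
  have hom: "homogeneous_ideal r I" and one: "1 \<notin> I" and lin: "I \<inter> forms r 1 = {0}"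
    and high: "\<And>i. i > e \<Longrightarrow> forms r i \<subseteq> I" and hv: "is_h_vector_of r I h"
    and lev: "\<And>i p. i < e \<Longrightarrow> p \<in> forms r i \<Longrightarrow> \<forall>q\<in>forms r 1. p * q \<in> I \<Longrightarrow> p \<in> I"
    using data unfolding level_data_def by auto
  have homI: "hom_component d p \<in> I" if "p \<in> I" for d p
    using that hom by (simp add: homogeneous_ideal_def)
  define z where "z = \<pi> f"
  have z0: "z \<noteq> 0" using f(2) by (simp add: z_def kernel)
  define J where "J = {p. \<pi> p \<in> poly.span {z}}"
  have IJ: "I \<subseteq> J"
  proof
    fix p assume "p \<in> I"
    then have "\<pi> p = 0" by (simp only: kernel)
    then show "p \<in> J" by (simp add: J_def poly.span_zero)
  qed
  have J_iff: "p \<in> J \<longleftrightarrow> (\<exists>c. p - poly_scale c f \<in> I)" for p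
  proof -
    have "\<pi> p = poly_scale c z \<longleftrightarrow> p - poly_scale c f \<in> I" for c
      using kernel[of "p - poly_scale c f"] by (simp add: \<pi>.diff \<pi>.scale z_def)
    then show ?thesis unfolding J_def poly.span_singleton by auto
  qed
  have JE: "\<exists>i c. i \<in> I \<and> p = i + poly_scale c f" if "p \<in> J" for p
    using that unfolding J_iff by (metis diff_add_cancel)
  have JI: "i + poly_scale c f \<in> J" if "i \<in> I" for i c
    using that unfolding J_iff by (intro exI[of _ c]) simp
  have fc: "f \<in> carrier (poly_ring r)" using f(1) by (rule forms_carrier)
  have sub: "J \<subseteq> carrier (poly_ring r)"
    using JE I_carrier fc by blast
  have fx: "f * q \<in> I" if "q \<in> carrier (poly_ring r)" "Poly_Mapping.lookup q 0 = 0" for q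
  proof (rule mult_in_ideal_if_vars[OF fc _ that])
    fix j assume "j < r"
    then have "f * poly_var j \<in> forms r (e + 1)" by (intro forms_mult f(1) poly_var_forms)
    then show "f * poly_var j \<in> I" using high[of "e + 1"] by auto
  qed
  have "poly.subspace J"
    unfolding J_def by (intro \<pi>.subspace_vimage[unfolded vimage_def] poly.subspace_span)
  moreover have "q * p \<in> J" if p: "p \<in> J" and q: "q \<in> carrier (poly_ring r)" for p q
  proof -
    obtain i c where i: "i \<in> I" "p = i + poly_scale c f" using JE[OF p] by blast
    \<comment> \<open>Splitting off the constant term \<open>a\<close> of \<open>q\<close>: the rest
      multiplies \<open>f\<close> into \<open>I\<close>, and \<open>a\<close> only rescales
      \<open>f\<close>.\<close>
    define a where "a = Poly_Mapping.lookup q 0"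
    define q' where "q' = q - poly_scale a 1"
    have q': "q' \<in> carrier (poly_ring r)" "Poly_Mapping.lookup q' 0 = 0"
      using q by (auto simp: q'_def a_def lookup_minus lookup_one)
    have "q * p = (q * i + poly_scale c (f * q')) + poly_scale (c * a) f"
      unfolding i(2) q'_def
      by (simp add: algebra_simps poly_scale_mult_left poly_scale_mult_right poly.scale_right_diff_distrib)
    moreover have "q * i + poly_scale c (f * q') \<in> I"
      using I_add[OF I_mult[OF i(1) q] I_scale[OF fx[OF q']]] .
    ultimately show ?thesis using JI by simp
  qed
  ultimately have ideal: "ideal J (poly_ring r)" by (intro ideal_poly_ringI sub)
  \<comment> \<open>Away from degree \<open>e\<close> the form \<open>f\<close> has no component, so
    \<open>J\<close> contains no more forms than \<open>I\<close>.\<close>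
  have forms_J: "p \<in> I" if p: "p \<in> forms r i" "p \<in> J" "i \<noteq> e" for p i
  proof -
    obtain j c where j: "j \<in> I" "p = j + poly_scale c f" using JE[OF p(2)] by blast
    have "hom_component i p = hom_component i j"
      unfolding j(2) using that(3) by (simp add: hom_component.add hom_component.scale hom_component_of_form[OF f(1)])
    then show ?thesis using homI[OF j(1), of i] hom_component_of_form[OF that(1), of i] by simp
  qed
  have homJ: "hom_component d p \<in> J" if p: "p \<in> J" for d p
  proof -
    obtain j c where j: "j \<in> I" "p = j + poly_scale c f" using JE[OF p] by blast
    have "hom_component d p = hom_component d j + poly_scale (if d = e then c else 0) f"
      unfolding j(2) by (simp add: hom_component.add hom_component.scale hom_component_of_form[OF f(1)])
    then show ?thesis using JI[OF homI[OF j(1)]] by simp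
  qed
  \<comment> \<open>\<open>\<rho>\<close> kills exactly the line of \<open>z\<close>, so its
    composite with \<open>\<pi>\<close> has kernel \<open>J\<close> and serves as quotient map for
    \<open>J\<close>.\<close>
  obtain \<rho> where \<rho>: "Vector_Spaces.linear poly_scale poly_scale \<rho>" "\<And>x. \<rho> x = 0 \<longleftrightarrow> x \<in> poly.span {z}"
    using poly.exists_linear_projection[OF poly.subspace_span[of "{z}"]] by blast
  have J_quot: "poly_quotient r J (\<rho> \<circ> \<pi>)"
    unfolding poly_quotient_def poly_quotient_axioms_def poly_ideal_def
    using ideal Vector_Spaces.linear_compose[OF linear \<rho>(1)] \<rho>(2) by (auto simp: J_def)
  interpret J: poly_quotient r J "\<rho> \<circ> \<pi>" by (rule J_quot)
  have vd: "poly.has_vdim (\<pi> ` forms r i) (h i)" for i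
    using hv has_dim_iff[OF forms_subset] unfolding is_h_vector_of_def graded_component_def by blast
  have vdJ: "poly.has_vdim (\<rho> ` \<pi> ` forms r i) ((h(e := n)) i)" for i
  proof (cases "i = e")
    case True
    have "poly.has_vdim (\<rho> ` \<pi> ` forms r e) n"
      using vd[of e] f(1) z0 \<rho>(2) unfolding he(1)
      by (intro poly.has_vdim_image_kernel_line[OF \<rho>(1), of _ _ z]) (auto simp: z_def)
    then show ?thesis using True by simp
  next
    case False
    have "\<pi> p = 0" if "p \<in> forms r i" "\<rho> (\<pi> p) = 0" for p
      using forms_J[OF that(1) _ False] that(2) unfolding \<rho>(2) kernel J_def by blast
    then have "poly.has_vdim (\<rho> ` \<pi> ` forms r i) (h i)"
      by (intro poly.has_vdim_image_inj[OF \<rho>(1) vd]) blast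
    then show ?thesis using False by simp
  qed
  have "level_data r J (h(e := n)) e"
    unfolding level_data_def
  proof (intro conjI allI impI ballI)
    show "homogeneous_ideal r J" using ideal homJ by (simp add: homogeneous_ideal_def)
    have "(1 :: 'k mpoly) \<in> forms r 0" by (auto simp: forms_def)
    then show "1 \<notin> J" using forms_J[of 1 0] one e by auto
    show "J \<inter> forms r 1 = {0}" using forms_J[of _ 1] lin IJ e by auto
    show "forms r i \<subseteq> J" if "i > e" for i using high[OF that] IJ by blast
    show "is_h_vector_of r J (h(e := n))"
      unfolding is_h_vector_of_def graded_component_def
      using J.has_dim_iff[OF forms_subset] vdJ unfolding image_comp[symmetric] by blast
    show "(h(e := n)) e > 0" using he by simp
    show "p \<in> J" if i: "i < e" and p: "p \<in> forms r i" and pq: "\<forall>q\<in>forms r 1. p * q \<in> J" for i p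
    proof (cases "i = e - 1")
      case True
      then have "p \<in> I" using line p pq by (simp add: J_def z_def)
      then show ?thesis using IJ by blast
    next
      case False
      \<comment> \<open>The product has degree \<open>i + 1 < e\<close>, where \<open>J\<close> adds
        nothing to \<open>I\<close>.\<close>
      have "p * q \<in> I" if "q \<in> forms r 1" for q
        using forms_J[OF forms_mult[OF p that]] pq that False i by auto
      then show ?thesis using lev[OF i p] IJ by blast
    qed
  qed
  then show ?thesis by (rule level_data_imp_level_h_vector)
qed

text \<open>Faithfulness of \<open>A_1\<close> on \<open>A_(e-1)\<close>, by descending induction on
  the degree: if \<open>l\<close> kills one degree, its products with the degree below are killed by
  all linear forms, hence vanish by levelness. In degree 0 this gives \<open>l\<close>
  itself.\<close>

lemma level_data_mult_forms_nondegenerate: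
  fixes I :: "'k::field mpoly set"
  assumes data: "level_data r I h e" and l: "l \<in> forms r 1" and e: "e \<ge> 1"
    and lf: "\<And>g. g \<in> forms r (e - 1) \<Longrightarrow> l * g \<in> I"
  shows "l \<in> I"
proof -
  have lev: "\<And>i p. i < e \<Longrightarrow> p \<in> forms r i \<Longrightarrow> \<forall>q\<in>forms r 1. p * q \<in> I \<Longrightarrow> p \<in> I"
    using data unfolding level_data_def by auto
  have "\<forall>g\<in>forms r (e - 1 - k). l * g \<in> I" if "k \<le> e - 1" for k
    using that
  proof (induction k)
    case 0
    then show ?case using lf by simp
  next
    case (Suc k)
    show ?case
    proof
      fix g :: "'k mpoly" assume g: "g \<in> forms r (e - 1 - Suc k)"
      have lg: "l * g \<in> forms r (1 + (e - 1 - Suc k))" using forms_mult[OF l g] .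
      have "l * g * x \<in> I" if x: "x \<in> forms r 1" for x
      proof -
        have "g * x \<in> forms r (e - 1 - k)" using forms_mult[OF g x] Suc.prems by (simp add: Suc_diff_Suc)
        then show ?thesis using Suc by (simp add: mult.assoc)
      qed
      then show "l * g \<in> I" using lev[OF _ lg] Suc.prems by auto
    qed
  qed
  from this[of "e - 1"] have "l * 1 \<in> I" by (auto simp: forms_def)
  then show ?thesis by simp
qed

theorem theorem4p2:
  fixes h :: "nat \<Rightarrow> nat" and e t :: nat
  assumes "level_h_vector TYPE('k::field_char_0) h"
    and "socle_degree h e"
    and "e \<ge> 1"
    and "h e = t"
    and "\<forall>i\<in>{1..e - 1}. int (h (e - i)) + (int t)\<^sup>2 - int t * int (h i) - 1 > 0"
  shows "level_h_vector TYPE('k) (h(e := t - 1))"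
proof -
  obtain r and I :: "'k mpoly set" where data: "level_data r I h e"
    using level_h_vector_imp_level_data[OF assms(1,2)] by blast
  have hom: "homogeneous_ideal r I" and one: "1 \<notin> I" and lin: "I \<inter> forms r 1 = {0}"
    and hv: "is_h_vector_of r I h"
    and lev: "\<And>i p. i < e \<Longrightarrow> p \<in> forms r i \<Longrightarrow> \<forall>q\<in>forms r 1. p * q \<in> I \<Longrightarrow> p \<in> I"
    using data unfolding level_data_def by auto
  interpret poly_ideal r I using hom by (simp add: poly_ideal_def homogeneous_ideal_def)
  obtain \<pi> where quot: "poly_quotient r I \<pi>" and proj: "\<And>p. p - \<pi> p \<in> I"
    using exists_quotient_map by blast
  interpret poly_quotient r I \<pi> by (rule quot)
  show ?thesis
  proof (cases "e = 1")
    case True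
    \<comment> \<open>A nonzero constant in \<open>I\<close> would bring 1 into \<open>I\<close>.
      Thus \<open>h 0 = 1\<close>.\<close>
    have "forms r 0 \<inter> I \<subseteq> {0}"
    proof -
      have "p = 0" if p: "p \<in> forms r 0" "p \<in> I" for p :: "'k mpoly"
      proof -
        obtain c where c: "p = poly_scale c 1"
          using p(1) unfolding forms_0_eq single_0_eq by blast
        have "poly_scale (inverse c) p \<in> I" using p(2) by (rule I_scale)
        then show ?thesis using one unfolding c by (cases "c = 0") auto
      qed
      then show ?thesis by blast
    qed
    then have "has_dim r I (graded_component r I 0) 1"
      by (rule has_dim_if_forms_Int_ideal_trivial[OF quot _ has_vdim_forms_0])
    moreover have "has_dim r I (graded_component r I 0) (h 0)"
      using hv by (simp add: is_h_vector_of_def)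
    ultimately have "h 0 = 1"
      using has_dim_unique[OF forms_subset] unfolding graded_component_def by blast
    then show ?thesis
      using assms(2) True by (intro level_h_vector_socle_degree_le_1) (auto simp: socle_degree_def)
  next
    case False
    then have e: "e \<ge> 2" using assms(3) by simp
    have t0: "t > 0" using assms(2,4) by (simp add: socle_degree_def)
    \<comment> \<open>As \<open>e \<ge> 2\<close>, the indices \<open>e - 1\<close> and 1 are both
      in range. The first feeds the dimension count; together they exclude
      \<open>t = 1\<close>.\<close>
    have ineq1: "int (h 1) + (int t)\<^sup>2 - int t * int (h (e - 1)) - 1 > 0"
      using assms(5)[rule_format, of "e - 1"] e by simp
    have ineq2: "int (h (e - 1)) + (int t)\<^sup>2 - int t * int (h 1) - 1 > 0"
      using assms(5)[rule_format, of 1] e by simp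
    have t2: "t \<ge> 2"
    proof (rule ccontr)
      assume "\<not> t \<ge> 2"
      then have "t = 1" using t0 by simp
      \<comment> \<open>For \<open>t = 1\<close> the two inequalities read
        \<open>h 1 > h (e - 1)\<close> and \<open>h (e - 1) > h 1\<close>.\<close>
      then show False using ineq1 ineq2 by simp
    qed
    have "int (t * h (e - 1) + 1) < int (h 1 + t * t)"
      using ineq1 by (simp add: power2_eq_square)
    then have ineq: "t * h (e - 1) + 1 < h 1 + t * t" by linarith
    have vd: "poly.has_vdim (\<pi> ` forms r i) (h i)" for i
      using hv has_dim_iff[OF forms_subset] unfolding is_h_vector_of_def graded_component_def by blast
    \<comment> \<open>Factors may be replaced by their representatives, since the errors
      \<open>p - \<pi> p\<close> and \<open>q - \<pi> q\<close> lie in \<open>I\<close>.\<close>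
    have \<pi>_mult: "\<pi> (\<pi> q * \<pi> p) = \<pi> (q * p)"
      if pq: "p \<in> carrier (poly_ring r)" "q \<in> carrier (poly_ring r)" for p q
    proof -
      have "\<pi> p \<in> carrier (poly_ring r)"
        using poly_ring_diff[OF pq(1) I_carrier[OF proj[of p]]] by simp
      then have "q * (p - \<pi> p) + (q - \<pi> q) * \<pi> p \<in> I"
        by (intro I_add I_mult I_mult' proj pq)
      then have "q * p - \<pi> q * \<pi> p \<in> I" by (simp add: algebra_simps)
      then have "\<pi> (q * p - \<pi> q * \<pi> p) = 0" by (simp only: kernel)
      then show ?thesis by (simp add: \<pi>.diff)
    qed
    \<comment> \<open>The bilinear map sending \<open>x\<close> and \<open>y\<close> to
      \<open>\<pi> (x * y)\<close> is the multiplication of \<open>A_1\<close> and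
      \<open>A_(e-1)\<close> into \<open>A_e\<close>, carried over to representatives.\<close>
    have "\<exists>z\<in>\<pi> ` forms r e. z \<noteq> 0 \<and> (\<forall>y\<in>\<pi> ` forms r (e - 1).
        (\<forall>x\<in>\<pi> ` forms r 1. \<pi> (x * y) \<in> poly.span {z}) \<longrightarrow> y = 0)"
    proof (rule poly.exists_line_containing_no_image[OF _ _ vd vd])
      have lin_l: "module_hom poly_scale poly_scale (\<lambda>y. \<pi> (x * y))" for x
        by unfold_locales (simp_all add: distrib_left \<pi>.add poly_scale_mult_right \<pi>.scale)
      then show "Vector_Spaces.linear poly_scale poly_scale (\<lambda>y. \<pi> (x * y))" for x
        by (simp add: module_hom_iff_linear)
      show "Vector_Spaces.linear poly_scale poly_scale (\<lambda>x. \<pi> (x * y))" for y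
      proof -
        have "(\<lambda>x. \<pi> (x * y)) = (\<lambda>x. \<pi> (y * x))" by (simp only: mult.commute)
        then show ?thesis using lin_l[of y] by (simp only: module_hom_iff_linear)
      qed
      show "poly.has_vdim (\<pi> ` forms r e) t" using vd[of e] assms(4) by simp
      show "t * h (e - 1) + 1 < h 1 + t * t" by (rule ineq)
      show "1 \<le> t" using t2 by simp
      show "\<pi> (x * y) \<in> \<pi> ` forms r e"
        if xy: "x \<in> \<pi> ` forms r 1" "y \<in> \<pi> ` forms r (e - 1)" for x y
      proof -
        obtain q p where q: "q \<in> forms r 1" "x = \<pi> q" and p: "p \<in> forms r (e - 1)" "y = \<pi> p"
          using xy by blast
        have "q * p \<in> forms r e" using forms_mult[OF q(1) p(1)] e by simp
        then show ?thesis unfolding q(2) p(2) \<pi>_mult[OF forms_carrier[OF p(1)] forms_carrier[OF q(1)]]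
          by (rule imageI)
      qed
      show "x = 0" if x: "x \<in> \<pi> ` forms r 1" and 0: "\<forall>y\<in>\<pi> ` forms r (e - 1). \<pi> (x * y) = 0" for x
      proof -
        obtain q where q: "q \<in> forms r 1" "x = \<pi> q" using x by blast
        have "q * g \<in> I" if g: "g \<in> forms r (e - 1)" for g
          using 0 g \<pi>_mult[OF forms_carrier[OF g] forms_carrier[OF q(1)]]
          unfolding q(2) kernel[symmetric] by simp
        then have "q \<in> I"
          using level_data_mult_forms_nondegenerate[OF data q(1) assms(3)] by blast
        then show ?thesis unfolding q(2) by (simp only: kernel)
      qed
      \<comment> \<open>On this side nondegeneracy is levelness in degree
        \<open>e - 1\<close>.\<close>
      show "y = 0" if y: "y \<in> \<pi> ` forms r (e - 1)" and 0: "\<forall>x\<in>\<pi> ` forms r 1. \<pi> (x * y) = 0" for y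
      proof -
        obtain p where p: "p \<in> forms r (e - 1)" "y = \<pi> p" using y by blast
        have "q * p \<in> I" if q: "q \<in> forms r 1" for q
          using 0 q \<pi>_mult[OF forms_carrier[OF p(1)] forms_carrier[OF q]]
          unfolding p(2) kernel[symmetric] by simp
        then have "\<forall>q\<in>forms r 1. p * q \<in> I" by (simp add: mult.commute)
        then have "p \<in> I" using lev[OF _ p(1)] e by auto
        then show ?thesis unfolding p(2) by (simp only: kernel)
      qed
    qed
    then obtain f where f: "f \<in> forms r e" "\<pi> f \<noteq> 0"
      and line: "\<And>p. p \<in> forms r (e - 1) \<Longrightarrow>
        \<forall>q\<in>forms r 1. \<pi> (\<pi> q * \<pi> p) \<in> poly.span {\<pi> f} \<Longrightarrow> \<pi> p = 0"
      by (smt (verit) imageE imageI)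
    show ?thesis
    proof (rule level_data_quotient_by_socle_element[OF data e quot proj f(1)])
      show "f \<notin> I" using f(2) by (simp add: kernel)
      \<comment> \<open>\<open>t \<ge> 2\<close> keeps the last entry positive, so the socle degree
        stays \<open>e\<close>.\<close>
      show "h e = Suc (t - 1)" "t - 1 > 0" using assms(4) t2 by auto
      show "p \<in> I" if p: "p \<in> forms r (e - 1)"
        and pq: "\<forall>q\<in>forms r 1. \<pi> (p * q) \<in> poly.span {\<pi> f}" for p
      proof -
        have "\<pi> p = 0"
          using pq \<pi>_mult[OF forms_carrier[OF p] forms_carrier]
          by (intro line[OF p]) (simp add: mult.commute)
        then show ?thesis by (simp only: kernel)
      qed
    qed
  qed
qed

end
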